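(* Let $P$ be a $d$-polytope with $n$ vertices and $m$ facets. Then $P$ is inscribable if and only if there exist real matrices $A\in\mathbb{R}^{n\times n}$, $B\in\mathbb{R}^{m\times m}$ and $S\in\mathbb{R}^{n\times m}$ such that the symmetric matrix $$X=\begin{bmatrix}1 & \mathbb{1}_n^\top & \mathbb{1}_m^\top\\ \mathbb{1}_n & A & S\\ \mathbb{1}_m & S^\top & B\end{bmatrix}$$ is positive semidefinite and has rank $d+1$, all diagonal entries of $A$ are equal to one and the same constant, all entries of $S$ are nonnegative, and $S$ has the same support (set of nonzero entries) as a slack matrix of $P$.
   Context: A polytope $P$ is inscribable if there is a polytope combinatorially equivalent to $P$ all of whose vertices lie on a sphere. For a $d$-polytope $P=\mathrm{conv}\{v_1,\ldots,v_n\}$ (with $v_1,\ldots,v_n$ its vertices) and an irredundant facet description $P=\{x\in\mathbb{R}^d: h_j^\top x\le c_j,\ j=1,\ldots,m\}$ (one inequality per facet), a slack matrix of $P$ is the $n\times m$ matrix $S$ with $S_{ij}=c_j-h_j^\top v_i$; it is entrywise nonnegative and $S_{ij}=0$ exactly when vertex $v_i$ lies on facet $j$. $\mathbb{1}_k$ denotes the all-ones vector in $\mathbb{R}^k$. *)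

theory Defs
  imports "HOL-Analysis.Analysis"
begin

(* Isomorphism of face lattices.  The relation face_of admits both improper faces,
   the empty set and the polytope itself. *)
definition combinatorially_equivalent ::
    "'a::euclidean_space set \<Rightarrow> 'b::euclidean_space set \<Rightarrow> bool" where
  "combinatorially_equivalent P Q \<longleftrightarrow>
     (\<exists>f. bij_betw f {F. F face_of P} {G. G face_of Q} \<and>
          (\<forall>F F'. F face_of P \<longrightarrow> F' face_of P \<longrightarrow> (F \<subseteq> F' \<longleftrightarrow> f F \<subseteq> f F')))"

(* The inscribed realization is sought in the ambient space of P.  For a full-dimensional P
   this is no restriction: a combinatorially equivalent polytope has the same dimension, and a
   sphere through its vertices meets its affine hull in a sphere. *)
definition inscribable :: "'a::euclidean_space set \<Rightarrow> bool" where
  "inscribable P \<longleftrightarrow>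
     (\<exists>Q :: 'a set. polytope Q \<and> combinatorially_equivalent P Q \<and>
        (\<exists>z r. 0 < r \<and> {v. v extreme_point_of Q} \<subseteq> sphere z r))"

(* The second conjunct is irredundancy: every inequality defines a facet, and every facet is
   defined by exactly one of the inequalities. *)
definition facet_description ::
    "'a::euclidean_space set \<Rightarrow> ('m::finite \<Rightarrow> 'a) \<Rightarrow> ('m \<Rightarrow> real) \<Rightarrow> bool" where
  "facet_description P h c \<longleftrightarrow>
     P = {x. \<forall>j. h j \<bullet> x \<le> c j} \<and>
     bij_betw (\<lambda>j. {x \<in> P. h j \<bullet> x = c j}) UNIV {F. F facet_of P}"

(* The index types 'n and 'm enumerate the vertices and the facets, in any order. *)
definition slack_matrix :: "'a::euclidean_space set \<Rightarrow> real^'m^'n \<Rightarrow> bool" where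
  "slack_matrix P S \<longleftrightarrow>
     (\<exists>(v :: 'n \<Rightarrow> 'a) h c.
        bij_betw v UNIV {x. x extreme_point_of P} \<and>
        facet_description P h c \<and>
        S = (\<chi> i j. c j - h j \<bullet> v i))"

definition same_support :: "real^'m^'n \<Rightarrow> real^'m^'n \<Rightarrow> bool" where
  "same_support S T \<longleftrightarrow> (\<forall>i j. S $ i $ j \<noteq> 0 \<longleftrightarrow> T $ i $ j \<noteq> 0)"

definition positive_semidefinite :: "real^'k^'k \<Rightarrow> bool" where
  "positive_semidefinite X \<longleftrightarrow> transpose X = X \<and> (\<forall>x. 0 \<le> x \<bullet> (X *v x))"

(* The symmetric block matrix with block rows (1, 1^T, 1^T), (1, A, S), (1, S^T, B). *)
definition bordered_matrix ::
    "real^'n^'n \<Rightarrow> real^'m^'n \<Rightarrow> real^'m^'m \<Rightarrow> real^(unit + 'n + 'm)^(unit + 'n + 'm)" where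
  "bordered_matrix A S B = (\<chi> p q.
     case p of
       Inl _ \<Rightarrow> 1
     | Inr (Inl i) \<Rightarrow>
         (case q of Inl _ \<Rightarrow> 1 | Inr (Inl k) \<Rightarrow> A $ i $ k | Inr (Inr j) \<Rightarrow> S $ i $ j)
     | Inr (Inr j) \<Rightarrow>
         (case q of Inl _ \<Rightarrow> 1 | Inr (Inl i) \<Rightarrow> transpose S $ j $ i | Inr (Inr k) \<Rightarrow> B $ j $ k))"

end

theory Submission
  imports Defs
begin

text \<open>Suppose \<open>P\<close> is equivalent to a polytope inscribed in the unit sphere, and let \<open>p\<close> be an interior
  point of the latter. The homogenized vertices \<open>(1, x)\<close> are lightlike and \<open>(1, p)\<close> is timelike, so
  reversing the sign of the Lorentz form on the Lorentz complement of \<open>(1, p)\<close> yields a Euclidean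
  form for which suitable multiples of the vertices have inner product 1 with \<open>(1, p)\<close> and one
  common length. With the vectors that represent the facet functionals they have \<open>X\<close> as Gram matrix.

  Conversely, the Schur complement of the corner entry of \<open>X\<close> is a Gram matrix of vectors \<open>u\<^sub>i\<close>,
  \<open>w\<^sub>j\<close> in dimension \<open>d\<close>. The \<open>u\<^sub>i\<close> lie on a sphere about the origin and satisfy
  \<open>- w\<^sub>j \<bullet> u\<^sub>i \<le> 1\<close> with equality exactly at the incidences of \<open>P\<close>. That these inequalities cut
  out the convex hull of the \<open>u\<^sub>i\<close> follows by induction over the faces of \<open>P\<close>: a line through a
  solution, parallel to the difference of two vertices of a face, leaves the solution set in the
  span of a facet of that face.\<close>

subsection \<open>Faces and dimension\<close>

lemma polytope_convex_hull_extreme_points: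
  fixes P :: "'a::euclidean_space set"
  assumes "polytope P"
  shows "P = convex hull {x. x extreme_point_of P}"
  using assms Krein_Milman_Minkowski polytope_imp_compact polytope_imp_convex by blast

lemma finite_extreme_points_polytope:
  fixes P :: "'a::euclidean_space set"
  assumes "polytope P"
  shows "finite {x. x extreme_point_of P}"
proof -
  obtain v where "finite v" "P = convex hull v"
    using assms polytope_def by blast
  then have "{x. x extreme_point_of P} \<subseteq> v"
    using extreme_point_of_convex_hull by blast
  then show ?thesis using \<open>finite v\<close> finite_subset by blast
qed

text \<open>A facet lies exactly one dimension below its face, while the integer \<open>g\<close>
  drops by at least one; descending through facets gives the bound. This is how dimensions are
  compared below, both along face isomorphisms and along the map \<open>U\<close>.\<close>

lemma aff_dim_le_strict_mono_on_faces:
  fixes P :: "'a::euclidean_space set" and g :: "'a set \<Rightarrow> int"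
  assumes P: "polytope P" and empty: "-1 \<le> g {}"
    and str: "\<And>F G. F face_of P \<Longrightarrow> G face_of P \<Longrightarrow> F \<subset> G \<Longrightarrow> g F < g G"
    and F: "F face_of P"
  shows "aff_dim F \<le> g F"
  using F
proof (induction "nat (aff_dim F + 1)" arbitrary: F rule: less_induct)
  case less
  have pF: "polytope F" using P less.prems face_of_polytope_polytope by blast
  consider "F = {}" | "aff_dim F = 0" | "aff_dim F > 0"
    using aff_dim_geq[of F] aff_dim_empty[of F] by linarith
  then show ?case
  proof cases
    case 1
    then show ?thesis using empty by simp
  next
    case 2
    then have "F \<noteq> {}" by auto
    then have "g {} < g F" using str[of "{}" F] less.prems by auto
    then show ?thesis using 2 empty by simp
  next
    case 3
    obtain G where G: "G facet_of F" using polytope_facet_exists[OF pF 3] .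
    then have GP: "G face_of P" and dG: "aff_dim G = aff_dim F - 1"
      using less.prems face_of_trans by (auto simp: facet_of_def)
    have "G \<subset> F" using G facet_of_irrefl facet_of_imp_subset by (metis psubsetI)
    then have "g G < g F" using str[OF GP less.prems] by blast
    moreover have "aff_dim G \<le> g G"
      by (rule less.hyps) (use dG GP 3 in auto)
    ultimately show ?thesis using dG by simp
  qed
qed

lemma face_of_psubset_aff_dim_less:
  fixes P :: "'a::euclidean_space set"
  assumes "F face_of P" "G face_of P" "F \<subset> G"
  shows "aff_dim F < aff_dim G"
  by (rule face_of_aff_dim_lt)
     (use assms face_of_imp_convex in \<open>auto simp: face_of_face\<close>)

text \<open>Strict inclusion of faces is preserved by \<open>f\<close> and by its inverse, so the
  preceding bound applies in both directions.\<close>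

lemma face_iso_aff_dim:
  fixes P :: "'a::euclidean_space set" and Q :: "'b::euclidean_space set"
  assumes P: "polytope P" and Q: "polytope Q"
    and bij: "bij_betw f {F. F face_of P} {G. G face_of Q}"
    and ord: "\<And>F F'. F face_of P \<Longrightarrow> F' face_of P \<Longrightarrow> F \<subseteq> F' \<longleftrightarrow> f F \<subseteq> f F'"
    and F: "F face_of P"
  shows "aff_dim (f F) = aff_dim F"
proof (rule antisym)
  let ?g = "inv_into {F. F face_of P} f"
  have fm: "f F face_of Q" if "F face_of P" for F
    using bij that by (auto simp: bij_betw_def)
  have gm: "?g G face_of P" if "G face_of Q" for G
    using bij_betw_inv_into[OF bij] that by (auto simp: bij_betw_def)
  have fg: "f (?g G) = G" if "G face_of Q" for G
    using bij_betw_inv_into_right[OF bij] that by simp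
  have gf: "?g (f F) = F" if "F face_of P" for F
    using bij_betw_inv_into_left[OF bij] that by simp
  show "aff_dim F \<le> aff_dim (f F)"
  proof (rule aff_dim_le_strict_mono_on_faces[OF P _ _ F])
    fix F G assume FG: "F face_of P" "G face_of P" "F \<subset> G"
    then have "f F \<subset> f G" using ord by (simp add: less_le_not_le)
    then show "aff_dim (f F) < aff_dim (f G)" using face_of_psubset_aff_dim_less fm FG by blast
  qed (simp add: aff_dim_geq)
  have "aff_dim (f F) \<le> aff_dim (?g (f F))"
  proof (rule aff_dim_le_strict_mono_on_faces[OF Q _ _ fm[OF F]])
    fix F G assume "F face_of Q" "G face_of Q" "F \<subset> G"
    then show "aff_dim (?g F) < aff_dim (?g G)"
      using ord[OF gm gm] fg gm by (metis face_of_psubset_aff_dim_less psubset_eq)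
  qed (simp add: aff_dim_geq)
  then show "aff_dim (f F) \<le> aff_dim F" using gf[OF F] by simp
qed

text \<open>A proper nonempty face is the intersection of the facets above it, so some facet
  \<open>K\<close> contains \<open>G\<close> but not \<open>F\<close>. Then
  \<open>F \<inter> K\<close> is a proper face of \<open>F\<close> containing \<open>G\<close>, and
  a dimension count leaves only \<open>G\<close>.\<close>

lemma facet_of_face_eq_Int_facet:
  fixes P :: "'a::euclidean_space set"
  assumes P: "polytope P" and F: "F face_of P" and G: "G facet_of F"
  obtains K where "K facet_of P" "G = F \<inter> K"
proof (cases "F = P")
  case True
  then show ?thesis using that[of G] G facet_of_imp_subset by blast
next
  case False
  have GF: "G face_of F" "G \<noteq> F" "G \<noteq> {}" using G facet_of_irrefl by (auto simp: facet_of_def)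
  have GP: "G face_of P" using GF F face_of_trans by blast
  have "G \<noteq> P" using GF F face_of_imp_subset by fastforce
  then have "G = \<Inter>{K. K facet_of P \<and> G \<subseteq> K}"
    using face_of_polyhedron[OF polytope_imp_polyhedron[OF P] GP] GF by blast
  then obtain K where K: "K facet_of P" "G \<subseteq> K" "\<not> F \<subseteq> K"
    using GF face_of_imp_subset by blast
  have KP: "K face_of P" using K facet_of_imp_face_of by blast
  have cF: "convex F" using F face_of_imp_convex by blast
  have "F \<inter> K face_of F" using KP F
    by (meson face_of_Int face_of_face inf_le1)
  then have lt: "aff_dim (F \<inter> K) < aff_dim F" using face_of_aff_dim_lt[OF cF] K by blast
  have sub: "G \<subseteq> F \<inter> K" using K GF face_of_imp_subset by blast
  have "G face_of (F \<inter> K)" using GP sub F KP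
    by (metis face_of_Int face_of_face)
  moreover have "convex (F \<inter> K)" using F KP face_of_Int face_of_imp_convex by blast
  ultimately have "G = F \<inter> K"
    using face_of_aff_dim_lt[of "F \<inter> K" G] lt G by (force simp: facet_of_def)
  then show ?thesis using that K by blast
qed

section \<open>Facet inequalities at new positions of the vertices\<close>

text \<open>Here \<open>u\<close> moves the vertices of \<open>P\<close> to new positions and
  \<open>H\<close> provides one functional per facet. Only signs and incidences at the vertices are
  assumed; the aim is that the inequalities cut out exactly the convex hull of the new points. The
  right-hand side 1 is the form in which the Schur complement delivers them.\<close>

locale facet_realization =
  fixes P :: "'a::euclidean_space set" and u :: "'a \<Rightarrow> 'b::euclidean_space"
    and H :: "'a set \<Rightarrow> 'b"
  assumes P: "polytope P"
    and le: "\<And>x K. x extreme_point_of P \<Longrightarrow> K facet_of P \<Longrightarrow> H K \<bullet> u x \<le> 1"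
    and eq: "\<And>x K. x extreme_point_of P \<Longrightarrow> K facet_of P \<Longrightarrow> H K \<bullet> u x = 1 \<longleftrightarrow> x \<in> K"
begin

definition U :: "'a set \<Rightarrow> 'b set" where
  "U F = u ` {x \<in> F. x extreme_point_of P}"

lemma U_mono: "F \<subseteq> G \<Longrightarrow> U F \<subseteq> U G"
  by (auto simp: U_def)

lemma extreme_point_not_in_subface:
  assumes "F face_of P" "G face_of P" "F \<subset> G"
  obtains x where "x extreme_point_of P" "x \<in> G" "x \<notin> F"
proof -
  have "\<not> {x. x extreme_point_of G} \<subseteq> F"
  proof
    assume "{x. x extreme_point_of G} \<subseteq> F"
    then have "convex hull {x. x extreme_point_of G} \<subseteq> F"
      using assms face_of_imp_convex hull_minimal by blast
    then show False
      using polytope_convex_hull_extreme_points[of G] face_of_polytope_polytope[OF P assms(2)] assms(3)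
      by blast
  qed
  then show ?thesis using that extreme_point_of_face[OF assms(2)] by blast
qed

lemma affine_hull_U_subset_hyperplane:
  assumes "K facet_of P" "F \<subseteq> K"
  shows "affine hull U F \<subseteq> {y. H K \<bullet> y = 1}"
  by (rule hull_minimal) (use assms eq in \<open>auto simp: U_def affine_hyperplane\<close>)

text \<open>Some facet \<open>K\<close> contains \<open>F\<close> but misses a vertex
  \<open>x\<close> of \<open>G\<close>. The hyperplane of \<open>H K\<close> then contains
  \<open>U F\<close> and not \<open>u x\<close>, so the affine hull grows.\<close>

lemma aff_dim_U_strict_mono:
  assumes F: "F face_of P" and G: "G face_of P" and FG: "F \<subset> G"
  shows "aff_dim (U F) < aff_dim (U G)"
proof -
  obtain x where x: "x extreme_point_of P" "x \<in> G" "x \<notin> F"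
    using extreme_point_not_in_subface[OF assms] .
  then have ux: "u x \<in> U G" by (auto simp: U_def)
  show ?thesis
  proof (cases "F = {}")
    case True
    then have "aff_dim (U F) = -1" by (simp add: U_def)
    moreover have "aff_dim (U G) \<noteq> -1" using ux aff_dim_empty[of "U G"] by auto
    ultimately show ?thesis using aff_dim_geq[of "U G"] by linarith
  next
    case False
    have "F \<noteq> P" using FG G face_of_imp_subset by blast
    then have "F = \<Inter>{K. K facet_of P \<and> F \<subseteq> K}"
      using face_of_polyhedron[OF polytope_imp_polyhedron[OF P] F False] by blast
    then obtain K where K: "K facet_of P" "F \<subseteq> K" "x \<notin> K" using x by blast
    have "u x \<notin> affine hull U F"
      using affine_hull_U_subset_hyperplane[OF K(1,2)] eq[OF x(1) K(1)] K(3) by auto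
    moreover have "affine hull U F \<subseteq> affine hull U G" using U_mono FG hull_mono by (metis psubsetE)
    ultimately show ?thesis using aff_dim_psubset hull_inc[OF ux] by blast
  qed
qed

lemma aff_dim_le_aff_dim_U:
  assumes "F face_of P"
  shows "aff_dim F \<le> aff_dim (U F)"
  by (rule aff_dim_le_strict_mono_on_faces[OF P _ _ assms])
     (auto simp: aff_dim_geq intro: aff_dim_U_strict_mono)

lemma facet_of_face_facts:
  assumes "F face_of P" "G facet_of F"
  shows "G face_of P" "G \<subset> F" "G \<noteq> {}" "aff_dim G = aff_dim F - 1" "G face_of F"
proof -
  show "G face_of F" "G \<noteq> {}" "aff_dim G = aff_dim F - 1" using assms by (auto simp: facet_of_def)
  then show "G face_of P" using assms(1) face_of_trans by blast
  have "G \<noteq> F" using assms(2) facet_of_irrefl by auto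
  then show "G \<subset> F" using assms(2) facet_of_imp_subset by blast
qed

text \<open>A squeeze: the dimension of \<open>U G\<close> is at least that of \<open>G\<close> and
  strictly below that of \<open>U F\<close>, which exceeds the dimension of \<open>G\<close> by one.
  Thus the equality of dimensions descends from a face to its facets.\<close>

lemma aff_dim_U_facet:
  assumes F: "F face_of P" and dF: "aff_dim (U F) = aff_dim F" and G: "G facet_of F"
  shows "aff_dim (U G) = aff_dim G"
  using aff_dim_U_strict_mono[of G F] aff_dim_le_aff_dim_U[of G] facet_of_face_facts[OF F G] F dF
  by simp

text \<open>The hyperplane meets the hull of \<open>U F\<close> without containing it, so it lowers
  the dimension by exactly one, which is also the drop from \<open>U F\<close> to
  \<open>U (F \<inter> K)\<close>. Nested affine sets of equal dimension coincide.\<close>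

lemma affine_hull_U_facet:
  assumes F: "F face_of P" and dF: "aff_dim (U F) = aff_dim F"
    and K: "K facet_of P" and FK: "(F \<inter> K) facet_of F"
  shows "affine hull U (F \<inter> K) = affine hull U F \<inter> {y. H K \<bullet> y = 1}"
proof (rule affine_dim_equal)
  note G = facet_of_face_facts[OF F FK]
  obtain x where x: "x extreme_point_of P" "x \<in> F" "x \<notin> F \<inter> K"
    using extreme_point_not_in_subface[OF G(1) F G(2)] .
  obtain x' where x': "x' extreme_point_of P" "x' \<in> F \<inter> K"
    using extreme_point_not_in_subface[of "{}" "F \<inter> K"] G(1,3) by auto
  show sub: "affine hull U (F \<inter> K) \<subseteq> affine hull U F \<inter> {y. H K \<bullet> y = 1}"
    using affine_hull_U_subset_hyperplane[OF K, of "F \<inter> K"] U_mono[of "F \<inter> K" F] hull_mono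
    by (metis Int_lower1 Int_lower2 le_inf_iff)
  have ne: "u x' \<in> affine hull U (F \<inter> K)"
    by (rule hull_inc) (use x' in \<open>auto simp: U_def\<close>)
  then show "affine hull U (F \<inter> K) \<noteq> {}" by auto
  have "u x \<in> affine hull U F" by (rule hull_inc) (use x in \<open>auto simp: U_def\<close>)
  moreover have "H K \<bullet> u x \<noteq> 1" using eq[OF x(1) K] x by auto
  ultimately have "\<not> affine hull U F \<subseteq> {y. H K \<bullet> y = 1}" by auto
  then have "aff_dim (affine hull U F \<inter> {y. H K \<bullet> y = 1}) = aff_dim (affine hull U F) - 1"
    using sub ne by (subst aff_dim_affine_Int_hyperplane) auto
  then show "aff_dim (affine hull U (F \<inter> K)) = aff_dim (affine hull U F \<inter> {y. H K \<bullet> y = 1})"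
    using aff_dim_U_facet[OF F dF FK] G(4) dF by (simp add: aff_dim_affine_hull)
qed (auto intro: affine_Int affine_hyperplane)

lemma finite_facets: "finite {K. K facet_of P}"
  by (rule finite_subset[OF _ finite_polytope_faces[OF P]]) (auto simp: facet_of_def)

text \<open>\<open>L\<close> and \<open>M\<close> cut the same facet out of \<open>G\<close>, so
  their hyperplanes have the same trace on the hull of \<open>U G\<close>. If \<open>z\<close>
  violated the inequality of \<open>L\<close>, the segment from a vertex off that facet to
  \<open>z\<close> would cross the common trace at an inner point, where \<open>M\<close> must be
  strict.\<close>

lemma facet_inequality_transfer:
  assumes G: "G face_of P" and dG: "aff_dim (U G) = aff_dim G"
    and L: "L facet_of P" and GL: "(G \<inter> L) facet_of G"
    and M: "M facet_of P" and GM: "G \<inter> M = G \<inter> L"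
    and z: "z \<in> affine hull U G" and Mz: "H M \<bullet> z \<le> 1"
  shows "H L \<bullet> z \<le> 1"
proof (rule ccontr)
  assume *: "\<not> H L \<bullet> z \<le> 1"
  note R = facet_of_face_facts[OF G GL]
  obtain x where x: "x extreme_point_of P" "x \<in> G" "x \<notin> G \<inter> L"
    using extreme_point_not_in_subface[OF R(1) G R(2)] .
  define a where "a = H L \<bullet> u x"
  define b where "b = H L \<bullet> z"
  have a: "a < 1" using eq[OF x(1) L] le[OF x(1) L] x by (auto simp: a_def)
  have "x \<notin> M" using x GM by blast
  then have Mx: "H M \<bullet> u x < 1" using eq[OF x(1) M] le[OF x(1) M] by auto
  have b: "b > 1" using * by (simp add: b_def)
  \<comment> \<open>Along the segment \<open>H L\<close> is affine with end values
    \<open>a < 1\<close> and \<open>b > 1\<close>; this is the parameter where it equals 1.\<close>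
  define s where "s = (1 - a) / (b - a)"
  have s: "0 < s" "s < 1" using a b by (auto simp: s_def field_simps)
  define q where "q = (1 - s) *\<^sub>R u x + s *\<^sub>R z"
  have ux: "u x \<in> affine hull U G" by (rule hull_inc) (use x in \<open>auto simp: U_def\<close>)
  have q: "q \<in> affine hull U G"
    unfolding q_def by (rule mem_affine) (use ux z in auto)
  have "H L \<bullet> q = (1 - s) * a + s * b" by (simp add: q_def a_def b_def inner_add_right)
  also have "\<dots> = a + s * (b - a)" by (simp add: algebra_simps)
  also have "\<dots> = 1" using a b by (simp add: s_def)
  finally have "q \<in> affine hull U (G \<inter> M)" using affine_hull_U_facet[OF G dG L GL] q unfolding GM by blast
  then have "H M \<bullet> q = 1" using affine_hull_U_facet[OF G dG M] GL unfolding GM by blast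
  moreover have "H M \<bullet> q = (1 - s) * (H M \<bullet> u x) + s * (H M \<bullet> z)"
    by (simp add: q_def inner_add_right)
  moreover have "(1 - s) * (H M \<bullet> u x) < (1 - s) * 1" using Mx s by (intro mult_strict_left_mono) auto
  moreover have "s * (H M \<bullet> z) \<le> s * 1" using Mz s by (intro mult_left_mono) auto
  ultimately show False by simp
qed

text \<open>The diamond property: a facet of a facet \<open>G\<close> of \<open>F\<close> is cut out of \<open>G\<close> by a second facet of \<open>F\<close>,
  so the inequalities of \<open>F\<close> imply those of \<open>G\<close>.\<close>

lemma facet_inequalities_inherited:
  assumes F: "F face_of P" and dF: "aff_dim (U F) = aff_dim F"
    and G: "G facet_of F"
    and z: "z \<in> affine hull U G"
    and Hz: "\<And>K. K facet_of P \<Longrightarrow> (F \<inter> K) facet_of F \<Longrightarrow> H K \<bullet> z \<le> 1"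
    and L: "L facet_of P" and GL: "(G \<inter> L) facet_of G"
  shows "H L \<bullet> z \<le> 1"
proof -
  note Gf = facet_of_face_facts[OF F G]
  note Rf = facet_of_face_facts[OF Gf(1) GL]
  have pF: "polytope F" using face_of_polytope_polytope[OF P F] .
  have "G \<inter> L face_of F" using Rf(5) Gf(5) face_of_trans by blast
  then have "G \<inter> L = \<Inter>{K. K facet_of F \<and> G \<inter> L \<subseteq> K}"
    using face_of_polyhedron[OF polytope_imp_polyhedron[OF pF]] Rf(2,3) Gf(2) by blast
  then obtain G' where G': "G' facet_of F" "G \<inter> L \<subseteq> G'" "\<not> G \<subseteq> G'"
    using Rf(2) by blast
  obtain M where M: "M facet_of P" "G' = F \<inter> M"
    using facet_of_face_eq_Int_facet[OF P F G'(1)] .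
  have GM: "G \<inter> M = G \<inter> G'" using M(2) Gf(2) by blast
  note G'f = facet_of_face_facts[OF F G'(1)]
  have GG': "G \<inter> G' face_of P" using Gf(1) G'f(1) face_of_Int by fastforce
  \<comment> \<open>\<open>G \<inter> G'\<close> is a proper face of \<open>G\<close> that contains
    \<open>G \<inter> L\<close>. The latter already has codimension one in \<open>G\<close>, so they
    are equal.\<close>
  have "aff_dim (G \<inter> G') < aff_dim G"
    using face_of_psubset_aff_dim_less[OF GG' Gf(1)] G'(3) by blast
  then have "\<not> G \<inter> L \<subset> G \<inter> G'"
    using face_of_psubset_aff_dim_less[OF Rf(1) GG'] Rf(4) by fastforce
  then have "G \<inter> M = G \<inter> L" using G'(2) GM by blast
  then show ?thesis
    using facet_inequality_transfer[OF Gf(1) aff_dim_U_facet[OF F dF G] L GL M(1)] z Hz[OF M(1)] G'(1) M(2)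
    by blast
qed

text \<open>The point is stopped at the first hyperplane that it reaches. All inequalities of
  \<open>F\<close> still hold there and one of them is tight, which puts the point in the affine
  hull belonging to a facet of \<open>F\<close>.\<close>

lemma ray_exit:
  assumes F: "F face_of P" and dF: "aff_dim (U F) = aff_dim F"
    and y: "y \<in> affine hull U F"
    and Hy: "\<And>K. K facet_of P \<Longrightarrow> (F \<inter> K) facet_of F \<Longrightarrow> H K \<bullet> y \<le> 1"
    and x: "x extreme_point_of P" "x \<in> F" and x': "x' extreme_point_of P" "x' \<in> F" and ne: "x \<noteq> x'"
  obtains t K where "t \<ge> 0" "K facet_of P" "(F \<inter> K) facet_of F"
    "y + t *\<^sub>R (u x' - u x) \<in> affine hull U (F \<inter> K)"
    "\<And>L. L facet_of P \<Longrightarrow> (F \<inter> L) facet_of F \<Longrightarrow> H L \<bullet> (y + t *\<^sub>R (u x' - u x)) \<le> 1"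
proof -
  define e where "e = u x' - u x"
  define Ks where "Ks = {K. K facet_of P \<and> (F \<inter> K) facet_of F \<and> H K \<bullet> e > 0}"
  have pF: "polytope F" using face_of_polytope_polytope[OF P F] .
  \<comment> \<open>The vertex \<open>x'\<close> is the intersection of the facets of
    \<open>F\<close> through it, so one of them misses \<open>x\<close>. Its functional increases
    along the ray, hence the ray does leave the solution set.\<close>
  have "{x'} face_of F" using x' F by (simp add: face_of_singleton extreme_point_of_face)
  then have "{x'} = \<Inter>{K. K facet_of F \<and> {x'} \<subseteq> K}"
    using face_of_polyhedron[OF polytope_imp_polyhedron[OF pF]] x(2) ne by blast
  then obtain G where G: "G facet_of F" "x' \<in> G" "x \<notin> G" using ne by blast
  obtain K0 where K0: "K0 facet_of P" "G = F \<inter> K0"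
    using facet_of_face_eq_Int_facet[OF P F G(1)] .
  have "H K0 \<bullet> u x' = 1" using eq[OF x'(1) K0(1)] G K0 by blast
  moreover have "H K0 \<bullet> u x < 1" using eq[OF x(1) K0(1)] le[OF x(1) K0(1)] G K0 x by force
  ultimately have "K0 \<in> Ks" using K0 G by (auto simp: Ks_def e_def inner_diff_right)
  have fin: "finite Ks" by (rule finite_subset[OF _ finite_facets]) (auto simp: Ks_def)
  \<comment> \<open>\<open>r K\<close> is the time at which the ray meets the hyperplane of
    \<open>K\<close>.\<close>
  define r where "r K = (1 - H K \<bullet> y) / (H K \<bullet> e)" for K
  define t where "t = Min (r ` Ks)"
  have "t \<in> r ` Ks" unfolding t_def by (rule Min_in) (use fin \<open>K0 \<in> Ks\<close> in auto)
  then obtain K where K: "K \<in> Ks" "t = r K" by blast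
  have t0: "t \<ge> 0" using K Hy by (auto simp: r_def Ks_def)
  have HL: "H L \<bullet> (y + t *\<^sub>R e) \<le> 1" if "L facet_of P" "(F \<inter> L) facet_of F" for L
  proof (cases "L \<in> Ks")
    case True
    then have "t \<le> r L" unfolding t_def using fin by simp
    then show ?thesis using True by (auto simp: r_def Ks_def field_simps inner_add_right)
  next
    case False
    then have "H L \<bullet> e \<le> 0" using that by (auto simp: Ks_def)
    then have "t * (H L \<bullet> e) \<le> 0" using t0 by (simp add: mult_nonneg_nonpos)
    then show ?thesis using Hy[OF that] by (simp add: inner_add_right)
  qed
  have "y + t *\<^sub>R e \<in> affine hull U F"
    unfolding e_def
    by (rule mem_affine_3_minus[OF affine_affine_hull y]) (auto intro!: hull_inc simp: U_def x x')
  moreover have "H K \<bullet> (y + t *\<^sub>R e) = 1" using K by (auto simp: r_def Ks_def inner_add_right)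
  ultimately have "y + t *\<^sub>R e \<in> affine hull U (F \<inter> K)"
    using affine_hull_U_facet[OF F dF, of K] K(1) by (auto simp: Ks_def)
  then show ?thesis using that[OF t0, of K] K(1) HL by (auto simp: Ks_def e_def)
qed

text \<open>\<open>ray_exit\<close> for the pairs \<open>(x, x')\<close> and \<open>(x', x)\<close>
  gives points on either side of \<open>y\<close> on one line. Each satisfies the inequalities of a
  facet of \<open>F\<close> by \<open>facet_inequalities_inherited\<close>, so the induction
  hypothesis puts it in the convex hull, and \<open>y\<close> lies between them.\<close>

lemma facet_inequalities_imp_convex_hull:
  assumes "F face_of P" "aff_dim (U F) = aff_dim F" "y \<in> affine hull U F"
    and "\<And>K. K facet_of P \<Longrightarrow> (F \<inter> K) facet_of F \<Longrightarrow> H K \<bullet> y \<le> 1"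
  shows "y \<in> convex hull U F"
  using assms
proof (induction "nat (aff_dim F + 1)" arbitrary: F y rule: less_induct)
  case less
  note F = less.prems(1) and dF = less.prems(2) and y = less.prems(3) and Hy = less.prems(4)
  have pF: "polytope F" using face_of_polytope_polytope[OF P F] .
  have extF: "{x. x extreme_point_of F} = {x \<in> F. x extreme_point_of P}"
    using extreme_point_of_face[OF F] by auto
  show ?case
  proof (cases "\<exists>x x'. x extreme_point_of P \<and> x \<in> F \<and> x' extreme_point_of P \<and> x' \<in> F \<and> x \<noteq> x'")
    \<comment> \<open>With at most one vertex, \<open>U F\<close> is empty or a singleton, where
      affine and convex hull agree.\<close>
    case single: False
    have "\<exists>a. U F \<subseteq> {a}"
    proof (cases "U F = {}")
      case False
      then obtain a where "a \<in> U F" by blast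
      then show ?thesis using single unfolding U_def by blast
    qed auto
    then obtain a where "U F = {} \<or> U F = {a}" by blast
    then show ?thesis using y by auto
  next
    case True
    have key: "\<exists>t\<ge>0. y + t *\<^sub>R (u x' - u x) \<in> convex hull U F"
      if x: "x extreme_point_of P" "x \<in> F" and x': "x' extreme_point_of P" "x' \<in> F" and ne: "x \<noteq> x'"
      for x x'
    proof -
      obtain t K where t: "t \<ge> 0" and K: "K facet_of P" "(F \<inter> K) facet_of F"
        and z: "y + t *\<^sub>R (u x' - u x) \<in> affine hull U (F \<inter> K)"
        and Hz: "\<And>L. L facet_of P \<Longrightarrow> (F \<inter> L) facet_of F \<Longrightarrow> H L \<bullet> (y + t *\<^sub>R (u x' - u x)) \<le> 1"
        using ray_exit[OF F dF y Hy x x' ne] by blast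
      note Gf = facet_of_face_facts[OF F K(2)]
      have "y + t *\<^sub>R (u x' - u x) \<in> convex hull U (F \<inter> K)"
      proof (rule less.hyps)
        show "nat (aff_dim (F \<inter> K) + 1) < nat (aff_dim F + 1)"
          using Gf(4) aff_dim_geq[of "F \<inter> K"] by auto
        show "H L \<bullet> (y + t *\<^sub>R (u x' - u x)) \<le> 1"
          if "L facet_of P" "(F \<inter> K \<inter> L) facet_of (F \<inter> K)" for L
          using facet_inequalities_inherited[OF F dF K(2) z Hz that] .
      qed (use Gf z aff_dim_U_facet[OF F dF K(2)] in auto)
      then show ?thesis using t hull_mono[OF U_mono[OF Int_lower1]] by blast
    qed
    obtain x x' where x: "x extreme_point_of P" "x \<in> F" "x' extreme_point_of P" "x' \<in> F" "x \<noteq> x'"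
      using True by blast
    define e where "e = u x' - u x"
    obtain t where t: "t \<ge> 0" "y + t *\<^sub>R e \<in> convex hull U F" using key x unfolding e_def by blast
    obtain t' where t': "t' \<ge> 0" "y - t' *\<^sub>R e \<in> convex hull U F"
      using key[of x' x] x by (auto simp: e_def scaleR_diff_right algebra_simps)
    show ?thesis
    proof (cases "t + t' = 0")
      case True
      then show ?thesis using t t' by (simp add: add_nonneg_eq_0_iff)
    next
      case False
      then have pos: "t + t' > 0" using t t' by auto
      \<comment> \<open>The weights are chosen so that the multiples of \<open>e\<close>
        cancel.\<close>
      have "(t' / (t + t')) *\<^sub>R (y + t *\<^sub>R e) + (t / (t + t')) *\<^sub>R (y - t' *\<^sub>R e) \<in> convex hull U F"
        by (rule convexD[OF convex_convex_hull t(2) t'(2)])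
           (use t t' pos in \<open>auto simp: add_divide_distrib[symmetric]\<close>)
      moreover have "(t' / (t + t')) *\<^sub>R (y + t *\<^sub>R e) + (t / (t + t')) *\<^sub>R (y - t' *\<^sub>R e)
          = (t' / (t + t') + t / (t + t')) *\<^sub>R y"
        by (simp add: algebra_simps)
      moreover have "t' / (t + t') + t / (t + t') = 1" using pos by (simp add: add_divide_distrib[symmetric])
      ultimately show ?thesis by simp
    qed
  qed
qed

text \<open>For the face \<open>P\<close> itself, the lower bound on the dimension of
  \<open>U P\<close> meets the dimension of the ambient space. So the affine hull of
  \<open>U P\<close> is everything, and the inequalities are the only condition left on
  \<open>y\<close>.\<close>

theorem convex_hull_eq_facet_inequalities:
  assumes "aff_dim P = DIM('b)"
  shows "convex hull (u ` {x. x extreme_point_of P}) = {y. \<forall>K. K facet_of P \<longrightarrow> H K \<bullet> y \<le> 1}"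
proof -
  have PP: "P face_of P" using P by (simp add: face_of_refl polytope_imp_convex)
  have UP: "U P = u ` {x. x extreme_point_of P}" by (auto simp: U_def extreme_point_of_def)
  have d: "aff_dim (U P) = DIM('b)" using aff_dim_le_aff_dim_U[OF PP] assms aff_dim_le_DIM[of "U P"] by simp
  have PK: "P \<inter> K = K" if "K facet_of P" for K using that facet_of_imp_subset by blast
  show ?thesis
  proof (intro subset_antisym subsetI)
    fix y assume "y \<in> {y. \<forall>K. K facet_of P \<longrightarrow> H K \<bullet> y \<le> 1}"
    then show "y \<in> convex hull (u ` {x. x extreme_point_of P})"
      using facet_inequalities_imp_convex_hull[OF PP, of y] d assms affine_hull_UNIV[of "U P"]
      by (auto simp: UP aff_dim_eq_full)
  next
    have "{y. \<forall>K. K facet_of P \<longrightarrow> H K \<bullet> y \<le> 1} = (\<Inter>K\<in>{K. K facet_of P}. {y. H K \<bullet> y \<le> 1})"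
      by blast
    then have "convex {y. \<forall>K. K facet_of P \<longrightarrow> H K \<bullet> y \<le> 1}"
      by (simp add: convex_INT convex_halfspace_le)
    then have "convex hull (u ` {x. x extreme_point_of P}) \<subseteq> {y. \<forall>K. K facet_of P \<longrightarrow> H K \<bullet> y \<le> 1}"
      by (rule hull_minimal[rotated]) (use le in auto)
    then show "y \<in> {y. \<forall>K. K facet_of P \<longrightarrow> H K \<bullet> y \<le> 1}"
      if "y \<in> convex hull (u ` {x. x extreme_point_of P})" for y using that by blast
  qed
qed

end

subsection \<open>Combinatorial equivalence from equal incidences\<close>

text \<open>\<open>J\<close> collects the constraints tight at a relative interior point
  \<open>x\<close> of \<open>F\<close>. A supporting face through \<open>x\<close> contains all of
  \<open>F\<close>. Conversely, if \<open>y\<close> is tight on \<open>J\<close>, the segment from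
  \<open>y\<close> to \<open>x\<close> can be prolonged a little inside the polyhedron, and the
  definition of a face yields \<open>y\<close>.\<close>

lemma face_of_halfspaces_eq_active:
  fixes h :: "'m::finite \<Rightarrow> 'a::euclidean_space"
  assumes F: "F face_of {x. \<forall>j. h j \<bullet> x \<le> c j}" and ne: "F \<noteq> {}"
  obtains J where "F = {x. (\<forall>j. h j \<bullet> x \<le> c j) \<and> (\<forall>j\<in>J. h j \<bullet> x = c j)}"
proof -
  let ?P = "{x. \<forall>j. h j \<bullet> x \<le> c j}"
  have PI: "?P = (\<Inter>j. {x. h j \<bullet> x \<le> c j})" by blast
  have conP: "convex ?P" unfolding PI by (intro convex_INT convex_halfspace_le)
  have conF: "convex F" using F face_of_imp_convex by blast
  have FP: "F \<subseteq> ?P" using F face_of_imp_subset by blast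
  obtain x where x: "x \<in> rel_interior F"
    using ne conF rel_interior_eq_empty by blast
  then have xF: "x \<in> F" using rel_interior_subset by blast
  define J where "J = {j. h j \<bullet> x = c j}"
  have "F = {x. (\<forall>j. h j \<bullet> x \<le> c j) \<and> (\<forall>j\<in>J. h j \<bullet> x = c j)}"
  proof (intro subset_antisym subsetI)
    fix y assume y: "y \<in> F"
    have "h j \<bullet> y = c j" if j: "j \<in> J" for j
    proof -
      have "(?P \<inter> {x. h j \<bullet> x = c j}) face_of ?P"
        by (rule face_of_Int_supporting_hyperplane_le[OF conP]) auto
      moreover have "x \<in> (?P \<inter> {x. h j \<bullet> x = c j}) \<inter> rel_interior F"
        using x xF FP j unfolding J_def by blast
      ultimately have "F \<subseteq> ?P \<inter> {x. h j \<bullet> x = c j}"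
        using subset_of_face_of[OF _ FP] by blast
      then show ?thesis using y by blast
    qed
    then show "y \<in> {x. (\<forall>j. h j \<bullet> x \<le> c j) \<and> (\<forall>j\<in>J. h j \<bullet> x = c j)}" using y FP by blast
  next
    fix y assume y: "y \<in> {x. (\<forall>j. h j \<bullet> x \<le> c j) \<and> (\<forall>j\<in>J. h j \<bullet> x = c j)}"
    show "y \<in> F"
    proof (cases "y = x")
      case True then show ?thesis using xF by simp
    next
      case False
      \<comment> \<open>Constraints in \<open>J\<close> remain tight on the whole line through
        \<open>x\<close> and \<open>y\<close>; the others have slack at \<open>x\<close> and survive
        a short step.\<close>
      have "\<forall>j. \<exists>e>0. \<forall>t. 0 \<le> t \<and> t \<le> e \<longrightarrow> h j \<bullet> (x + t *\<^sub>R (x - y)) \<le> c j"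
      proof
        fix j
        show "\<exists>e>0. \<forall>t. 0 \<le> t \<and> t \<le> e \<longrightarrow> h j \<bullet> (x + t *\<^sub>R (x - y)) \<le> c j"
        proof (cases "j \<in> J")
          case True
          then have "h j \<bullet> (x + t *\<^sub>R (x - y)) \<le> c j" for t
            using y by (simp add: J_def inner_add_right inner_diff_right)
          then show ?thesis by (intro exI[of _ 1]) auto
        next
          case False
          define s where "s = c j - h j \<bullet> x"
          define m where "m = \<bar>h j \<bullet> (x - y)\<bar> + 1"
          have s: "s > 0" using False xF FP by (auto simp: J_def s_def less_le)
          have m: "m > 0" by (simp add: m_def add_nonneg_pos)
          have "h j \<bullet> (x + t *\<^sub>R (x - y)) \<le> c j" if t: "0 \<le> t" "t \<le> s / m" for t
          proof -
            have "t * (h j \<bullet> (x - y)) \<le> t * m" using t by (intro mult_left_mono) (auto simp: m_def)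
            also have "\<dots> \<le> s" using t m by (simp add: field_simps)
            finally show ?thesis by (simp add: inner_add_right s_def)
          qed
          then show ?thesis using s m by (intro exI[of _ "s / m"]) auto
        qed
      qed
      then obtain e where e: "\<And>j. e j > 0" "\<And>j t. 0 \<le> t \<Longrightarrow> t \<le> e j \<Longrightarrow> h j \<bullet> (x + t *\<^sub>R (x - y)) \<le> c j"
        by metis
      define t where "t = Min (range e)"
      have t: "t > 0" "\<And>j. t \<le> e j" using e(1) by (auto simp: t_def)
      define w where "w = x + t *\<^sub>R (x - y)"
      have w: "w \<in> ?P" using e(2) t by (auto simp: w_def less_imp_le)
      have "x \<in> open_segment w y"
      proof -
        have "x = (1 - t / (1 + t)) *\<^sub>R w + (t / (1 + t)) *\<^sub>R y"
        proof -
          have "(1 - t / (1 + t)) *\<^sub>R w = (1 / (1 + t)) *\<^sub>R w" using t(1) by (simp add: field_simps)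
          also have "\<dots> = (1 / (1 + t)) *\<^sub>R ((1 + t) *\<^sub>R x - t *\<^sub>R y)" by (simp add: w_def algebra_simps)
          also have "\<dots> = x - (t / (1 + t)) *\<^sub>R y" using t(1) by (simp add: scaleR_diff_right)
          finally show ?thesis by simp
        qed
        moreover have "w \<noteq> y"
        proof
          assume "w = y"
          then have "(1 + t) *\<^sub>R (x - y) = 0" by (simp add: w_def algebra_simps)
          then show False using t(1) False by simp
        qed
        ultimately show ?thesis using t(1)
          by (auto simp: in_segment intro!: exI[of _ "t / (1 + t)"])
      qed
      moreover have "y \<in> ?P" using y by blast
      ultimately show ?thesis using F w xF unfolding face_of_def by blast
    qed
  qed
  then show ?thesis using that by blast
qed

lemma face_of_convex_hull_range:
  fixes V :: "'n::finite \<Rightarrow> 'a::euclidean_space"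
  assumes F: "F face_of (convex hull range V)"
  shows "F = convex hull (V ` {i. V i \<in> F})"
proof -
  have "compact (range V)" by (simp add: finite_imp_compact)
  then obtain S where S: "S \<subseteq> range V" "F = convex hull S" using face_of_convex_hull_subset F by blast
  then have "S \<subseteq> V ` {i. V i \<in> F}" using hull_subset[of S convex] by blast
  then have "F \<subseteq> convex hull (V ` {i. V i \<in> F})" using S hull_mono by blast
  moreover have "convex hull (V ` {i. V i \<in> F}) \<subseteq> F"
    by (rule hull_minimal) (use F face_of_imp_convex in auto)
  ultimately show ?thesis by blast
qed

text \<open>The index sets on the right depend on the incidences alone, which makes face lattices
  comparable. \<open>J = {}\<close> gives the whole polytope; the empty face is inserted separately
  because it need not arise from any \<open>J\<close>.\<close>

lemma faces_bij_closed_vertex_sets: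
  fixes V :: "'n::finite \<Rightarrow> 'a::euclidean_space" and h :: "'m::finite \<Rightarrow> 'a"
  assumes V: "P = convex hull range V" and H: "P = {x. \<forall>j. h j \<bullet> x \<le> c j}"
  shows "bij_betw (\<lambda>F. {i. V i \<in> F}) {F. F face_of P}
    (insert {} {I. \<exists>J. I = {i. \<forall>j\<in>J. h j \<bullet> V i = c j}})"
  unfolding bij_betw_def
proof (intro conjI)
  show "inj_on (\<lambda>F. {i. V i \<in> F}) {F. F face_of P}"
    using face_of_convex_hull_range[of _ V] V by (auto intro!: inj_onI) (metis (no_types, lifting))+
  have VP: "V i \<in> P" for i using V hull_subset[of "range V" convex] by blast
  show "(\<lambda>F. {i. V i \<in> F}) ` {F. F face_of P} = insert {} {I. \<exists>J. I = {i. \<forall>j\<in>J. h j \<bullet> V i = c j}}"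
  proof (intro subset_antisym subsetI)
    fix I assume "I \<in> (\<lambda>F. {i. V i \<in> F}) ` {F. F face_of P}"
    then obtain F where F: "F face_of P" "I = {i. V i \<in> F}" by blast
    show "I \<in> insert {} {I. \<exists>J. I = {i. \<forall>j\<in>J. h j \<bullet> V i = c j}}"
    proof (cases "F = {}")
      case False
      then obtain J where "F = {x. (\<forall>j. h j \<bullet> x \<le> c j) \<and> (\<forall>j\<in>J. h j \<bullet> x = c j)}"
        using face_of_halfspaces_eq_active F(1) H by blast
      then have "I = {i. \<forall>j\<in>J. h j \<bullet> V i = c j}" using F(2) VP H by blast
      then show ?thesis by blast
    qed (use F in auto)
  next
    fix I assume I: "I \<in> insert {} {I. \<exists>J. I = {i. \<forall>j\<in>J. h j \<bullet> V i = c j}}"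
    show "I \<in> (\<lambda>F. {i. V i \<in> F}) ` {F. F face_of P}"
    proof (cases "I = {}")
      case True
      then show ?thesis by (intro image_eqI[of _ _ "{}"]) auto
    next
      case False
      then obtain J where J: "I = {i. \<forall>j\<in>J. h j \<bullet> V i = c j}" using I by blast
      have con: "convex P" using V by simp
      have face: "(P \<inter> {x. h j \<bullet> x = c j}) face_of P" for j
        by (rule face_of_Int_supporting_hyperplane_le[OF con]) (use H in auto)
      have "(\<Inter>(insert P ((\<lambda>j. P \<inter> {x. h j \<bullet> x = c j}) ` J))) face_of P"
        by (rule face_of_Inter) (use face face_of_refl[OF con] in auto)
      moreover have "I = {i. V i \<in> \<Inter>(insert P ((\<lambda>j. P \<inter> {x. h j \<bullet> x = c j}) ` J))}"
        using J VP by auto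
      ultimately show ?thesis by blast
    qed
  qed
qed

lemma combinatorially_equivalent_of_incidence:
  fixes V :: "'n::finite \<Rightarrow> 'a::euclidean_space" and h :: "'m::finite \<Rightarrow> 'a"
    and V' :: "'n \<Rightarrow> 'b::euclidean_space" and h' :: "'m \<Rightarrow> 'b"
  assumes P: "P = convex hull range V" "P = {x. \<forall>j. h j \<bullet> x \<le> c j}"
    and Q: "Q = convex hull range V'" "Q = {x. \<forall>j. h' j \<bullet> x \<le> c' j}"
    and inc: "\<And>i j. h j \<bullet> V i = c j \<longleftrightarrow> h' j \<bullet> V' i = c' j"
  shows "combinatorially_equivalent P Q"
proof -
  define g where "g F = {i. V i \<in> F}" for F
  define g' where "g' F = {i. V' i \<in> F}" for F
  define C where "C = insert {} {I. \<exists>J. I = {i. \<forall>j\<in>J. h j \<bullet> V i = c j}}"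
  have bg: "bij_betw g {F. F face_of P} C"
    using faces_bij_closed_vertex_sets[OF P] unfolding g_def C_def .
  have bg': "bij_betw g' {F. F face_of Q} C"
    using faces_bij_closed_vertex_sets[OF Q] unfolding g'_def C_def inc .
  have og: "F \<subseteq> F' \<longleftrightarrow> g F \<subseteq> g F'" if "F face_of P" "F' face_of P" for F F'
    using face_of_convex_hull_range[of F V] face_of_convex_hull_range[of F' V] that P(1)
      hull_mono[of "V ` g F" "V ` g F'" convex] unfolding g_def by blast
  have og': "F \<subseteq> F' \<longleftrightarrow> g' F \<subseteq> g' F'" if "F face_of Q" "F' face_of Q" for F F'
    using face_of_convex_hull_range[of F V'] face_of_convex_hull_range[of F' V'] that Q(1)
      hull_mono[of "V' ` g' F" "V' ` g' F'" convex] unfolding g'_def by blast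
  define f where "f = inv_into {F. F face_of Q} g' \<circ> g"
  have bf: "bij_betw f {F. F face_of P} {F. F face_of Q}"
    unfolding f_def using bg bij_betw_inv_into[OF bg'] bij_betw_trans by blast
  have gf: "g' (f F) = g F" if "F face_of P" for F
    using bij_betw_inv_into_right[OF bg'] bg that by (auto simp: f_def bij_betw_def)
  have "F \<subseteq> F' \<longleftrightarrow> f F \<subseteq> f F'" if "F face_of P" "F' face_of P" for F F'
  proof -
    have "f F face_of Q" "f F' face_of Q" using bf that by (auto simp: bij_betw_def)
    then show ?thesis using og[OF that] og' gf that by metis
  qed
  then show ?thesis unfolding combinatorially_equivalent_def using bf by blast
qed

subsection \<open>Gram vectors of positive semidefinite matrices\<close>

lemma matrix_vector_mult_axis:
  fixes X :: "real^'k^'l"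
  shows "(X *v axis p 1) $ i = X $ i $ p"
  by (simp add: matrix_vector_mul_component inner_axis)

lemma positive_semidefinite_sym:
  assumes "positive_semidefinite X"
  shows "X $ i $ j = X $ j $ i"
proof -
  have "transpose X = X" using assms by (simp add: positive_semidefinite_def)
  then have "transpose X $ i $ j = X $ i $ j" by simp
  then show ?thesis by (simp add: transpose_def)
qed

text \<open>These two identities carry the next two lemmas: the range of the Schur complement lies
  in that of \<open>X\<close>, and within the vectors whose coordinate \<open>p\<close>
  vanishes.\<close>

lemma schur_complement_apply:
  fixes X :: "real^'k^'k"
  assumes p: "X $ p $ p \<noteq> 0"
  defines "Y \<equiv> (\<chi> i j. X $ i $ j - X $ i $ p * X $ p $ j / X $ p $ p)"
  shows "Y *v x = X *v (x - ((X *v x) $ p / X $ p $ p) *\<^sub>R axis p 1)"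
    and "(Y *v x) $ p = 0"
proof -
  have entry: "(Y *v x) $ i = (X *v x) $ i - X $ i $ p / X $ p $ p * (X *v x) $ p" for i
  proof -
    have "(Y *v x) $ i = (\<Sum>j\<in>UNIV. X $ i $ j * x $ j - X $ i $ p / X $ p $ p * (X $ p $ j * x $ j))"
      by (simp add: Y_def matrix_vector_mult_def algebra_simps)
    then show ?thesis
      by (simp add: matrix_vector_mult_def sum_subtractf sum_distrib_left)
  qed
  show "(Y *v x) $ p = 0" using entry[of p] p by simp
  have "(X *v (x - ((X *v x) $ p / X $ p $ p) *\<^sub>R axis p 1)) $ i
      = (X *v x) $ i - X $ i $ p / X $ p $ p * (X *v x) $ p" for i
    by (simp add: matrix_vector_mult_diff_distrib matrix_vector_mult_scaleR matrix_vector_mult_axis)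
  then show "Y *v x = X *v (x - ((X *v x) $ p / X $ p $ p) *\<^sub>R axis p 1)"
    by (simp add: vec_eq_iff entry)
qed

lemma schur_complement_positive_semidefinite:
  fixes X :: "real^'k^'k"
  assumes X: "positive_semidefinite X" and p: "X $ p $ p \<noteq> 0"
  shows "positive_semidefinite (\<chi> i j. X $ i $ j - X $ i $ p * X $ p $ j / X $ p $ p)" (is "positive_semidefinite ?Y")
  unfolding positive_semidefinite_def
proof (intro conjI allI)
  show "transpose ?Y = ?Y"
    using positive_semidefinite_sym[OF X] by (simp add: transpose_def vec_eq_iff mult.commute)
  fix x
  define t where "t = (X *v x) $ p / X $ p $ p"
  define w where "w = x - t *\<^sub>R axis p 1"
  have Y: "?Y *v x = X *v w" and Yp: "(?Y *v x) $ p = 0"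
    unfolding w_def t_def by (rule schur_complement_apply[OF p])+
  have "x \<bullet> (?Y *v x) = w \<bullet> (?Y *v x)"
    using Yp by (simp add: w_def inner_diff_left inner_axis')
  also have "\<dots> \<ge> 0" using X by (simp add: Y positive_semidefinite_def)
  finally show "0 \<le> x \<bullet> (?Y *v x)" by simp
qed

text \<open>Column \<open>p\<close> of \<open>X\<close> has a nonzero entry at \<open>p\<close>, so
  it lies in the range of \<open>X\<close> but not in that of the Schur complement.\<close>

lemma schur_complement_rank_less:
  fixes X :: "real^'k^'k"
  assumes p: "X $ p $ p \<noteq> 0"
  shows "rank (\<chi> i j. X $ i $ j - X $ i $ p * X $ p $ j / X $ p $ p) < rank X" (is "rank ?Y < _")
proof -
  have sub: "range (\<lambda>x. ?Y *v x) \<subseteq> range (\<lambda>x. X *v x)"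
    using schur_complement_apply(1)[OF p] by auto
  have "X *v axis p 1 \<notin> range (\<lambda>x. ?Y *v x)"
  proof (rule notI)
    assume "X *v axis p 1 \<in> range (\<lambda>x. ?Y *v x)"
    then obtain x where "X *v axis p 1 = ?Y *v x" by blast
    then have "(X *v axis p 1) $ p = 0" using schur_complement_apply(2)[OF p, of x] by simp
    then show False using p by (simp only: matrix_vector_mult_axis)
  qed
  then have "range (\<lambda>x. ?Y *v x) \<subset> range (\<lambda>x. X *v x)" using sub by blast
  moreover have "subspace (range (\<lambda>x. ?Y *v x))" "subspace (range (\<lambda>x. X *v x))"
    by (intro linear_subspace_image matrix_vector_mul_linear subspace_UNIV)+
  ultimately show ?thesis
    unfolding rank_dim_range by (intro dim_psubset) (simp add: span_eq_iff[THEN iffD2])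
qed

lemma positive_semidefinite_zero_diagonal:
  fixes X :: "real^'k^'k"
  assumes X: "positive_semidefinite X" and d: "\<And>i. X $ i $ i = 0"
  shows "X = 0"
proof -
  have "X $ i $ j = 0" for i j
  proof -
    have q: "0 \<le> s * X $ i $ j" for s :: real
    proof -
      have "0 \<le> (axis i 1 + s *\<^sub>R axis j 1) \<bullet> (X *v (axis i 1 + s *\<^sub>R axis j 1))"
        using X by (simp add: positive_semidefinite_def)
      also have "\<dots> = 2 * s * X $ i $ j"
        using d positive_semidefinite_sym[OF X, of i j]
        by (simp add: matrix_vector_right_distrib matrix_vector_mult_scaleR inner_add_left inner_add_right
            inner_axis' matrix_vector_mult_axis)
      finally show ?thesis by simp
    qed
    show ?thesis using q[of 1] q[of "-1"] by simp
  qed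
  then show ?thesis by (simp add: vec_eq_iff)
qed

lemma positive_semidefinite_diagonal_nonneg:
  fixes X :: "real^'k^'k"
  assumes "positive_semidefinite X"
  shows "0 \<le> X $ i $ i"
proof -
  have "0 \<le> axis i 1 \<bullet> (X *v axis i 1)" using assms unfolding positive_semidefinite_def by blast
  then show ?thesis by (simp add: inner_axis' matrix_vector_mult_axis)
qed

text \<open>Each nonzero pivot splits off one rank-one term and lowers the rank. Without such a
  pivot, semidefiniteness forces \<open>X = 0\<close>.\<close>

lemma positive_semidefinite_sum_of_squares:
  fixes X :: "real^'k^'k"
  assumes "positive_semidefinite X" "rank X \<le> r"
  shows "\<exists>f::nat \<Rightarrow> 'k \<Rightarrow> real. \<forall>i j. X $ i $ j = (\<Sum>k<r. f k i * f k j)"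
  using assms
proof (induction r arbitrary: X)
  case 0
  then have "X = 0" by (simp add: rank_eq_0)
  then show ?case by simp
next
  case (Suc r)
  show ?case
  proof (cases "\<exists>p. X $ p $ p \<noteq> 0")
    case False
    then have "X = 0" using positive_semidefinite_zero_diagonal Suc.prems(1) by blast
    then show ?thesis by (intro exI[of _ "\<lambda>_ _. 0"]) simp
  next
    case True
    then obtain p where p: "X $ p $ p \<noteq> 0" by blast
    let ?Y = "\<chi> i j. X $ i $ j - X $ i $ p * X $ p $ j / X $ p $ p"
    have "rank ?Y \<le> r" using schur_complement_rank_less[OF p] Suc.prems(2) by simp
    then obtain f where f: "\<And>i j. ?Y $ i $ j = (\<Sum>k<r. f k i * f k j)"
      using Suc.IH[OF schur_complement_positive_semidefinite[OF Suc.prems(1) p]] by blast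
    \<comment> \<open>Column \<open>p\<close> over the root of the pivot: its products are exactly
      the terms subtracted in the Schur complement.\<close>
    define f' where "f' k i = (if k = r then X $ i $ p / sqrt (X $ p $ p) else f k i)" for k i
    have "X $ i $ j = (\<Sum>k<Suc r. f' k i * f' k j)" for i j
    proof -
      have "(\<Sum>k<Suc r. f' k i * f' k j) = (\<Sum>k<r. f k i * f k j) + f' r i * f' r j"
        by (simp add: f'_def)
      also have "f' r i * f' r j = X $ i $ p * X $ p $ j / X $ p $ p"
        using positive_semidefinite_sym[OF Suc.prems(1), of j p]
          positive_semidefinite_diagonal_nonneg[OF Suc.prems(1), of p]
        by (simp add: f'_def)
      finally show ?thesis using f[of i j] by simp
    qed
    then show ?thesis by blast
  qed
qed

lemma positive_semidefinite_gram:
  fixes X :: "real^'k^'k"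
  assumes "positive_semidefinite X" "rank X \<le> CARD('d)"
  obtains g :: "'k \<Rightarrow> real^'d" where "\<And>i j. X $ i $ j = g i \<bullet> g j"
proof -
  obtain f :: "nat \<Rightarrow> 'k \<Rightarrow> real" where f: "\<And>i j. X $ i $ j = (\<Sum>k<CARD('d). f k i * f k j)"
    using positive_semidefinite_sum_of_squares[OF assms] by blast
  obtain b where b: "bij_betw b (UNIV :: 'd set) {..<CARD('d)}"
    using ex_bij_betw_finite_nat[OF finite_class.finite_UNIV] by (metis lessThan_atLeast0)
  have "X $ i $ j = (\<chi> a. f (b a) i) \<bullet> (\<chi> a. f (b a) j)" for i j
    unfolding f inner_vec_def using sum.reindex_bij_betw[OF b, of "\<lambda>k. f k i * f k j"] by simp
  then show ?thesis using that[of "\<lambda>i. \<chi> a. f (b a) i"] by blast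
qed

subsection \<open>Points on the unit sphere and the Lorentz form\<close>

lemma gram_matrix_positive_semidefinite:
  fixes g :: "'k::finite \<Rightarrow> 'e::euclidean_space"
  shows "positive_semidefinite (\<chi> i j. g i \<bullet> g j)"
  unfolding positive_semidefinite_def
proof (intro conjI allI)
  show "transpose (\<chi> i j. g i \<bullet> g j) = (\<chi> i j. g i \<bullet> g j)"
    by (simp add: transpose_def inner_commute)
  fix x :: "real^'k"
  have "x \<bullet> ((\<chi> i j. g i \<bullet> g j) *v x) = (\<Sum>i\<in>UNIV. x $ i *\<^sub>R g i) \<bullet> (\<Sum>j\<in>UNIV. x $ j *\<^sub>R g j)"
    by (simp add: inner_vec_def matrix_vector_mult_def inner_sum_left inner_sum_right sum_distrib_left
        mult.assoc mult.commute mult.left_commute)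
       (simp add: inner_commute)
  then show "0 \<le> x \<bullet> ((\<chi> i j. g i \<bullet> g j) *v x)" by simp
qed

text \<open>The columns are the images of the vectors \<open>g j\<close> under \<open>M\<close>,
  whose kernel is orthogonal to all of them; hence \<open>M\<close> is injective on their
  span.\<close>

lemma gram_matrix_rank:
  fixes g :: "'k::finite \<Rightarrow> 'e::euclidean_space"
  shows "rank (\<chi> i j. g i \<bullet> g j) = dim (range g)"
proof -
  define M :: "'e \<Rightarrow> real^'k" where "M y = (\<chi> i. g i \<bullet> y)" for y
  have lin: "linear M"
    by (rule linearI) (simp_all add: M_def vec_eq_iff inner_add_right)
  have inj: "inj_on M (span (range g))"
  proof (subst linear_inj_on_iff_eq_0[OF lin subspace_span], intro ballI impI)
    fix y assume y: "y \<in> span (range g)" "M y = 0"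
    then have "g i \<bullet> y = 0" for i by (simp add: M_def vec_eq_iff)
    then have "orthogonal y (g i)" for i by (simp add: orthogonal_def inner_commute)
    then have "orthogonal y y" using orthogonal_to_span[OF y(1)] by blast
    then show "y = 0" by (simp add: orthogonal_def)
  qed
  have "column j (\<chi> i j. g i \<bullet> g j) = M (g j)" for j by (simp add: column_def M_def vec_eq_iff)
  then have "columns (\<chi> i j. g i \<bullet> g j) = M ` range g" by (auto simp: columns_def)
  then show ?thesis unfolding column_rank_def by (simp add: dim_image_eq[OF lin inj])
qed

lemma span_homogenization:
  fixes x :: "'n \<Rightarrow> 'a::euclidean_space"
  assumes "affine hull range x = UNIV"
  shows "span (range (\<lambda>i. (1::real, x i))) = UNIV"
proof -
  let ?V = "span (range (\<lambda>i. (1::real, x i)))"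
  have aff: "affine {y. (1, y) \<in> ?V}"
    unfolding affine_def
  proof (intro allI ballI impI)
    fix y z and s t :: real
    assume "y \<in> {y. (1, y) \<in> ?V}" "z \<in> {y. (1, y) \<in> ?V}" "s + t = 1"
    then have "s *\<^sub>R (1, y) + t *\<^sub>R (1, z) \<in> ?V" by (intro span_add span_scale) auto
    then show "s *\<^sub>R y + t *\<^sub>R z \<in> {y. (1, y) \<in> ?V}" using \<open>s + t = 1\<close> by simp
  qed
  have "affine hull range x \<subseteq> {y. (1, y) \<in> ?V}"
    using aff by (intro hull_minimal) (auto intro: span_base)
  then have one: "(1, y) \<in> ?V" for y using assms by blast
  have "(s, y) \<in> ?V" for s y
  proof -
    have "(1, y) + (s - 1) *\<^sub>R (1, 0) \<in> ?V" by (intro span_add span_scale one)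
    then show ?thesis by simp
  qed
  then show ?thesis by auto
qed

text \<open>Let \<open>k\<close> be the Lorentz square of the timelike vector \<open>e = (1, p)\<close>, and \<open>\<beta>\<close> the Lorentz form.
  Then \<open>2 \<beta>(e, y) \<beta>(e, z) / k - \<beta>(y, z)\<close> is positive definite.  The following map is an isometry
  of this form, scaled by \<open>1 / k\<close>, into a Euclidean space.  Scaling a lightlike vector \<open>(1, x)\<close> to have
  inner product 1 with \<open>e\<close> gives it squared length 2, whatever \<open>x\<close> is; this replaces the projective
  transformation of the ball that moves \<open>p\<close> to the centre.\<close>

definition wick_map :: "'a \<Rightarrow> real \<times> 'a \<Rightarrow> real \<times> real \<times> 'a::euclidean_space" where
  "wick_map p y = (1 / (1 - p \<bullet> p)) *\<^sub>R
     (fst y - p \<bullet> snd y, p \<bullet> (snd y - fst y *\<^sub>R p), sqrt (1 - p \<bullet> p) *\<^sub>R (snd y - fst y *\<^sub>R p))"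

lemma linear_wick_map: "linear (wick_map p)"
  by (rule linearI)
     (simp_all add: wick_map_def algebra_simps inner_add_right add_divide_distrib diff_divide_distrib)

text \<open>Before the scaling by \<open>1 / k\<close>, the first coordinate is the Lorentz product
  with \<open>e\<close>, and the other two contribute \<open>- k\<close> times the Lorentz form of
  the components complementary to \<open>e\<close>.\<close>

lemma inner_wick_map:
  fixes p :: "'a::euclidean_space"
  assumes "p \<bullet> p < 1"
  defines "k \<equiv> 1 - p \<bullet> p"
  shows "wick_map p (s, x) \<bullet> wick_map p (t, y) =
    2 * (s - p \<bullet> x) * (t - p \<bullet> y) / k\<^sup>2 - (s * t - x \<bullet> y) / k"
proof -
  have k: "k > 0" using assms by simp
  define w where "w s x = (s - p \<bullet> x, p \<bullet> (x - s *\<^sub>R p), sqrt k *\<^sub>R (x - s *\<^sub>R p))" for s x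
  have wm: "wick_map p (s, x) = (1 / k) *\<^sub>R w s x" for s x
    by (simp add: wick_map_def w_def k_def)
  have "sqrt k * (sqrt k * z) = k * z" for z
    using k by (simp flip: mult.assoc)
  then have "w s x \<bullet> w t y =
    (s - p \<bullet> x) * (t - p \<bullet> y) + (p \<bullet> (x - s *\<^sub>R p)) * (p \<bullet> (y - t *\<^sub>R p))
      + k * ((x - s *\<^sub>R p) \<bullet> (y - t *\<^sub>R p))"
    by (simp add: w_def)
  also have "\<dots> = 2 * (s - p \<bullet> x) * (t - p \<bullet> y) - k * (s * t - x \<bullet> y)"
    by (simp add: k_def inner_diff_left inner_diff_right inner_commute algebra_simps)
  finally have "wick_map p (s, x) \<bullet> wick_map p (t, y) =
      (2 * (s - p \<bullet> x) * (t - p \<bullet> y) - k * (s * t - x \<bullet> y)) / k\<^sup>2"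
    by (simp add: wm power2_eq_square)
  then show ?thesis using k by (simp add: diff_divide_distrib power2_eq_square)
qed

lemma inj_wick_map:
  fixes p :: "'a::euclidean_space"
  assumes p: "p \<bullet> p < 1"
  shows "inj (wick_map p)"
proof (subst linear_injective_0[OF linear_wick_map], intro allI impI)
  fix y assume y: "wick_map p y = 0"
  have "fst (wick_map p y) = 0" "snd (snd (wick_map p y)) = 0" unfolding y by simp_all
  then have "fst y - p \<bullet> snd y = 0" "snd y - fst y *\<^sub>R p = 0"
    using p unfolding wick_map_def fst_scaleR snd_scaleR fst_conv snd_conv scaleR_eq_0_iff by auto
  then have "snd y = fst y *\<^sub>R p" "fst y = p \<bullet> snd y" by simp_all
  then have "fst y = fst y * (p \<bullet> p)" by (metis inner_scaleR_right)
  then have "fst y = 0" using p by simp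
  then show "y = 0" using \<open>snd y = fst y *\<^sub>R p\<close> by (simp add: prod_eq_iff)
qed

lemma bordered_matrix_of_unit_sphere:
  fixes x :: "'n::finite \<Rightarrow> 'a::euclidean_space" and h :: "'m::finite \<Rightarrow> 'a"
  assumes x: "\<And>i. norm (x i) = 1" and p: "norm p < 1"
    and le: "\<And>i j. h j \<bullet> x i \<le> c j" and less: "\<And>j. h j \<bullet> p < c j"
    and aff: "affine hull range x = UNIV"
  obtains A :: "real^'n^'n" and B :: "real^'m^'m" and S :: "real^'m^'n"
  where "positive_semidefinite (bordered_matrix A S B)"
    "rank (bordered_matrix A S B) = DIM('a) + 1"
    "\<And>i. A $ i $ i = 2" "\<And>i j. 0 \<le> S $ i $ j" "\<And>i j. S $ i $ j = 0 \<longleftrightarrow> h j \<bullet> x i = c j"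
proof -
  have pp: "p \<bullet> p < 1" using p by (simp add: norm_eq_sqrt_inner)
  define k where "k = 1 - p \<bullet> p"
  have k: "k > 0" using pp by (simp add: k_def)
  define l where "l i = 1 - p \<bullet> x i" for i
  define L where "L j = c j - p \<bullet> h j" for j
  have l: "l i > 0" for i
    using norm_cauchy_schwarz[of p "x i"] x[of i] p by (simp add: l_def)
  have L: "L j > 0" for j using less[of j] by (simp add: L_def inner_commute)
  \<comment> \<open>\<open>l i\<close> is the Lorentz product of \<open>e\<close> with
    \<open>(1, x i)\<close>; the factor makes the Euclidean inner product with \<open>e\<close>
    equal to 1.\<close>
  define a where "a i = (k / l i) *\<^sub>R (1::real, x i)" for i
  \<comment> \<open>The Lorentz product of \<open>(c j, h j)\<close> with \<open>(1, x i)\<close> is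
    the slack. Changing the sign on the complement of \<open>e\<close> turns it into the Euclidean
    product, up to the factor \<open>1 / k\<close>; \<open>k / L j\<close> again normalizes the
    product with \<open>e\<close>.\<close>
  define b where "b j = (k / L j) *\<^sub>R ((2 * L j / k) *\<^sub>R (1::real, p) - (c j, h j))" for j
  define f where "f q = (case q of Inl _ \<Rightarrow> (1, p) | Inr (Inl i) \<Rightarrow> a i | Inr (Inr j) \<Rightarrow> b j)"
    for q :: "unit + 'n + 'm"
  define g where "g q = wick_map p (f q)" for q
  define A :: "real^'n^'n" where "A = (\<chi> i j. wick_map p (a i) \<bullet> wick_map p (a j))"
  define B :: "real^'m^'m" where "B = (\<chi> i j. wick_map p (b i) \<bullet> wick_map p (b j))"
  define S :: "real^'m^'n" where "S = (\<chi> i j. wick_map p (a i) \<bullet> wick_map p (b j))"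
  note W = inner_wick_map[OF pp, folded k_def]
  note lin = linear_scale[OF linear_wick_map] linear_diff[OF linear_wick_map]
  have ee: "wick_map p (1, p) \<bullet> wick_map p (1, p) = 1"
    using k unfolding W by (simp add: k_def[symmetric] power2_eq_square)
  have e: "wick_map p (1, p) \<bullet> wick_map p (t, y) = (t - p \<bullet> y) / k" for t y
    using k unfolding W by (simp add: k_def[symmetric] power2_eq_square field_simps)
  have ea: "wick_map p (1, p) \<bullet> wick_map p (a i) = 1" for i
    using k l[of i] by (simp add: a_def lin e l_def[symmetric] del: scaleR_Pair)
  have eb: "wick_map p (1, p) \<bullet> wick_map p (b j) = 1" for j
  proof -
    have "wick_map p (1, p) \<bullet> wick_map p (c j, h j) = L j / k" by (simp add: e L_def)
    then show ?thesis
      using k L[of j] by (simp add: b_def lin ee inner_diff_right del: scaleR_Pair)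
  qed
  have ae: "wick_map p (a i) \<bullet> wick_map p (1, p) = 1" for i
    using ea[of i] by (simp only: inner_commute)
  have be: "wick_map p (b j) \<bullet> wick_map p (1, p) = 1" for j
    using eb[of j] by (simp only: inner_commute)
  have ab: "wick_map p (b j) \<bullet> wick_map p (a i) = wick_map p (a i) \<bullet> wick_map p (b j)" for i j
    by (rule inner_commute)
  have "g q \<bullet> g q' = bordered_matrix A S B $ q $ q'" for q q'
    by (cases q; cases q')
       (auto simp: bordered_matrix_def g_def f_def A_def B_def S_def transpose_def
          ee ea eb ae be ab split: sum.splits)
  then have X: "bordered_matrix A S B = (\<chi> q q'. g q \<bullet> g q')" by (simp add: vec_eq_iff)
  \<comment> \<open>The vectors \<open>a i\<close> alone span, since the points \<open>x i\<close>
    affinely span the space; the injective \<open>wick_map\<close> preserves the dimension.\<close>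
  have "span (range f) = UNIV"
  proof -
    have "(1, x i) \<in> span (range f)" for i
    proof -
      have "(l i / k) *\<^sub>R f (Inr (Inl i)) \<in> span (range f)" by (intro span_scale span_base) auto
      then show ?thesis using k l[of i] by (simp add: f_def a_def)
    qed
    then have "span (range (\<lambda>i. (1, x i))) \<subseteq> span (range f)"
      by (intro span_minimal) auto
    then show ?thesis using span_homogenization[OF aff] by blast
  qed
  then have "dim (range f) = DIM('a) + 1"
    by (metis DIM_prod DIM_real add.commute dim_UNIV dim_span)
  moreover have "dim (range g) = dim (range f)"
  proof -
    have "range g = wick_map p ` range f" by (auto simp: g_def)
    then show ?thesis
      using dim_image_eq[OF linear_wick_map] inj_wick_map[OF pp] by (metis inj_on_subset subset_UNIV)
  qed
  ultimately have rank: "rank (bordered_matrix A S B) = DIM('a) + 1"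
    unfolding X gram_matrix_rank by simp
  have A2: "A $ i $ i = 2" for i
  proof -
    \<comment> \<open>As \<open>(1, x i)\<close> is lightlike, only the first term of the form
      remains, and normalization turns it into 2.\<close>
    have "x i \<bullet> x i = 1" using x[of i] by (simp add: norm_eq_1)
    then have "wick_map p (1, x i) \<bullet> wick_map p (1, x i) = 2 * l i * l i / k\<^sup>2"
      unfolding W by (simp add: l_def)
    then show ?thesis
      using k l[of i] by (simp add: A_def a_def lin power2_eq_square del: scaleR_Pair)
  qed
  have S: "S $ i $ j = k * (c j - h j \<bullet> x i) / (l i * L j)" for i j
  proof -
    have "wick_map p (1, x i) \<bullet> wick_map p (1, p) = l i / k"
      using e[of 1 "x i"] by (simp add: inner_commute l_def)
    moreover have "wick_map p (1, x i) \<bullet> wick_map p (c j, h j) =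
        2 * l i * L j / k\<^sup>2 - (c j - h j \<bullet> x i) / k"
      unfolding W by (simp add: l_def L_def inner_commute)
    ultimately show ?thesis
      using k l[of i] L[of j]
      by (simp add: S_def a_def b_def lin inner_diff_right del: scaleR_Pair)
         (simp add: field_simps power2_eq_square)
  qed
  show ?thesis
  proof (rule that[OF _ rank A2])
    show "positive_semidefinite (bordered_matrix A S B)"
      unfolding X by (rule gram_matrix_positive_semidefinite)
    show "0 \<le> S $ i $ j" for i j
      unfolding S using k l[of i] L[of j] le[of j i] by simp
    show "S $ i $ j = 0 \<longleftrightarrow> h j \<bullet> x i = c j" for i j
      unfolding S using k l[of i] L[of j] by auto
  qed
qed

subsection \<open>The characterization\<close>

text \<open>A segment from an interior point to a point outside \<open>P\<close> leaves
  \<open>P\<close> in some facet. The chosen inequality of that facet is strict at the start and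
  tight at the exit, hence violated at the end.\<close>

lemma facet_description_exists:
  fixes P :: "'a::euclidean_space set" and e :: "'m::finite \<Rightarrow> 'a set"
  assumes P: "polytope P" and d: "aff_dim P = DIM('a)"
    and e: "bij_betw e UNIV {F. F facet_of P}"
  obtains h c where "facet_description P h c" "\<And>j. {x \<in> P. h j \<bullet> x = c j} = e j"
proof -
  have pP: "polyhedron P" using P polytope_imp_polyhedron by blast
  have ef: "e j facet_of P" for j using e by (auto simp: bij_betw_def)
  have "\<exists>a b. P \<subseteq> {x. a \<bullet> x \<le> b} \<and> e j = P \<inter> {x. a \<bullet> x = b}" for j
    using facet_of_polyhedron[OF pP ef[of j]] by metis
  then obtain h c where hc: "\<And>j. P \<subseteq> {x. h j \<bullet> x \<le> c j}" "\<And>j. e j = P \<inter> {x. h j \<bullet> x = c j}"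
    by metis
  have eq: "{x \<in> P. h j \<bullet> x = c j} = e j" for j using hc(2) by blast
  have bd: "P - interior P = \<Union>{F. F facet_of P}"
    using rel_boundary_of_polyhedron[OF pP] rel_interior_interior[of P] d aff_dim_eq_full by metis
  have "P \<noteq> {}" using d by auto
  then have "interior P \<noteq> {}"
    using rel_interior_interior[of P] rel_interior_eq_empty[OF polytope_imp_convex[OF P]] d
    by (simp add: aff_dim_eq_full)
  then obtain x0 where x0: "x0 \<in> interior P" by blast
  then have x0P: "x0 \<in> P" using interior_subset by blast
  have less: "h j \<bullet> x0 < c j" for j
  proof -
    have "x0 \<notin> e j" using bd ef x0 by blast
    then show ?thesis using hc[of j] x0P by force
  qed
  have "P = {x. \<forall>j. h j \<bullet> x \<le> c j}"
  proof (intro subset_antisym subsetI)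
    fix y assume y: "y \<in> {x. \<forall>j. h j \<bullet> x \<le> c j}"
    show "y \<in> P"
    proof (rule ccontr)
      assume nP: "y \<notin> P"
      have "closed_segment x0 y \<inter> frontier P \<noteq> {}"
        by (rule connected_Int_frontier) (use x0P nP in auto)
      then obtain z where z: "z \<in> closed_segment x0 y" "z \<in> frontier P" by blast
      have zP: "z \<in> P" "z \<notin> interior P"
        using z(2) closure_closed[OF polytope_imp_closed[OF P]] by (auto simp: frontier_def)
      then obtain F where F: "F facet_of P" "z \<in> F" using bd by blast
      obtain j where "F = e j" using e F(1) by (auto simp: bij_betw_def)
      then have hz: "h j \<bullet> z = c j" using F eq[of j] by blast
      obtain t where t: "0 \<le> t" "t \<le> 1" "z = (1 - t) *\<^sub>R x0 + t *\<^sub>R y"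
        using z(1) by (auto simp: in_segment)
      have "t \<noteq> 1" using t zP nP by auto
      then have "(1 - t) * (h j \<bullet> x0) < (1 - t) * c j" using less t by simp
      moreover have "t * (h j \<bullet> y) \<le> t * c j" using y t by (simp add: mult_left_mono)
      moreover have "c j = (1 - t) * (h j \<bullet> x0) + t * (h j \<bullet> y)"
        using hz t(3) by (simp add: inner_add_right)
      ultimately show False by (simp add: algebra_simps)
    qed
  qed (use hc(1) in blast)
  then have "facet_description P h c" unfolding facet_description_def eq using e by simp
  then show ?thesis using that eq by blast
qed

section \<open>From an inscribed polytope to the matrix\<close>

lemma sphere_vertices_imp_bordered_matrix:
  fixes x :: "'n::finite \<Rightarrow> 'a::euclidean_space" and h :: "'m::finite \<Rightarrow> 'a"
  assumes r: "r > 0" and x: "range x \<subseteq> sphere z r" and d: "aff_dim (range x) = DIM('a)"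
    and le: "\<And>i j. h j \<bullet> x i \<le> c j" and h: "\<And>j. h j \<noteq> 0"
  obtains A :: "real^'n^'n" and B :: "real^'m^'m" and S :: "real^'m^'n"
  where "positive_semidefinite (bordered_matrix A S B)"
    "rank (bordered_matrix A S B) = DIM('a) + 1"
    "\<And>i. A $ i $ i = 2" "\<And>i j. 0 \<le> S $ i $ j" "\<And>i j. S $ i $ j = 0 \<longleftrightarrow> h j \<bullet> x i = c j"
proof -
  define Q where "Q = convex hull range x"
  have "aff_dim Q = DIM('a)" using d by (simp add: Q_def aff_dim_convex_hull)
  then have "affine hull Q = UNIV" by (simp add: aff_dim_eq_full)
  moreover have "Q \<noteq> {}" by (simp add: Q_def)
  ultimately have "interior Q \<noteq> {}"
    using rel_interior_interior[of Q] rel_interior_eq_empty[of Q] by (simp add: Q_def)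
  then obtain p where p: "p \<in> interior Q" by blast
  have "Q \<subseteq> cball z r" unfolding Q_def
    by (rule hull_minimal) (use x sphere_cball in auto)
  then have pz: "dist z p < r" using p interior_mono[of Q "cball z r"] by (auto simp: interior_cball)
  have hp: "h j \<bullet> p < c j" for j
  proof -
    have "Q \<subseteq> {y. h j \<bullet> y \<le> c j}" unfolding Q_def
      by (rule hull_minimal) (use le in \<open>auto simp: convex_halfspace_le\<close>)
    then have "interior Q \<subseteq> {y. h j \<bullet> y < c j}"
      using interior_mono interior_halfspace_le[OF h] by blast
    then show ?thesis using p by blast
  qed
  \<comment> \<open>The sphere becomes the unit sphere; the functionals are rescaled inversely, so
    all slacks keep their values.\<close>
  define x' where "x' i = (1 / r) *\<^sub>R (x i - z)" for i
  define p' where "p' = (1 / r) *\<^sub>R (p - z)"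
  define h' where "h' j = r *\<^sub>R h j" for j
  define c' where "c' j = c j - h j \<bullet> z" for j
  have hx: "h' j \<bullet> x' i = h j \<bullet> x i - h j \<bullet> z" for i j
    using r by (simp add: h'_def x'_def inner_diff_right diff_divide_distrib)
  have "norm (x' i) = 1" for i
    using x r by (auto simp: x'_def dist_norm norm_minus_commute image_subset_iff)
  moreover have "norm p' < 1" using pz r by (simp add: p'_def dist_norm norm_minus_commute)
  moreover have "h' j \<bullet> x' i \<le> c' j" for i j using le by (simp add: hx c'_def)
  moreover have "h' j \<bullet> p' < c' j" for j
    using hp[of j] r by (simp add: h'_def p'_def c'_def inner_diff_right diff_divide_distrib)
  moreover have "affine hull range x' = UNIV"
  proof -
    have "range x' = (*\<^sub>R) (1 / r) ` ((+) (- z) ` range x)" by (auto simp: x'_def)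
    also have "aff_dim \<dots> = aff_dim ((+) (- z) ` range x)"
      by (rule aff_dim_injective_linear_image) (use r in \<open>auto simp: linear_scaleR inj_def\<close>)
    also have "\<dots> = aff_dim (range x)" by (rule aff_dim_translation_eq)
    finally have "aff_dim (range x') = aff_dim (range x)" .
    then show ?thesis using d by (simp add: aff_dim_eq_full)
  qed
  ultimately obtain A :: "real^'n^'n" and B :: "real^'m^'m" and S :: "real^'m^'n"
    where X: "positive_semidefinite (bordered_matrix A S B)"
    "rank (bordered_matrix A S B) = DIM('a) + 1"
    "\<And>i. A $ i $ i = 2" "\<And>i j. 0 \<le> S $ i $ j" and S: "\<And>i j. S $ i $ j = 0 \<longleftrightarrow> h' j \<bullet> x' i = c' j"
    using bordered_matrix_of_unit_sphere[of x' p' h' c'] by metis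
  have "S $ i $ j = 0 \<longleftrightarrow> h j \<bullet> x i = c j" for i j by (simp add: S hx c'_def)
  then show ?thesis using that X by blast
qed

lemma inscribable_imp_bordered_matrix:
  fixes P :: "(real^'d) set"
  assumes P: "polytope P" and d: "aff_dim P = int CARD('d)"
    and v: "bij_betw v (UNIV :: 'n::finite set) {x. x extreme_point_of P}"
    and e: "bij_betw e (UNIV :: 'm::finite set) {F. F facet_of P}"
    and insc: "inscribable P"
  shows "\<exists>(A :: real^'n^'n) (B :: real^'m^'m) (S :: real^'m^'n).
       positive_semidefinite (bordered_matrix A S B) \<and>
       rank (bordered_matrix A S B) = CARD('d) + 1 \<and>
       (\<exists>a. \<forall>i. A $ i $ i = a) \<and>
       (\<forall>i j. 0 \<le> S $ i $ j) \<and>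
       (\<exists>T. slack_matrix P T \<and> same_support S T)"
proof -
  obtain Q :: "(real^'d) set" and z r where Q: "polytope Q" "combinatorially_equivalent P Q"
    and r: "0 < r" "{v. v extreme_point_of Q} \<subseteq> sphere z r"
    using insc unfolding inscribable_def by blast
  obtain f where f: "bij_betw f {F. F face_of P} {G. G face_of Q}"
    and ord: "\<And>F F'. F face_of P \<Longrightarrow> F' face_of P \<Longrightarrow> F \<subseteq> F' \<longleftrightarrow> f F \<subseteq> f F'"
    using Q(2) unfolding combinatorially_equivalent_def by blast
  have ff: "f F face_of Q" if "F face_of P" for F using f that by (auto simp: bij_betw_def)
  have dim: "aff_dim (f F) = aff_dim F" if "F face_of P" for F
    using face_iso_aff_dim[OF P Q(1) f ord that] .
  have surj: "\<exists>F. F face_of P \<and> f F = G" if "G face_of Q" for G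
  proof -
    have "G \<in> f ` {F. F face_of P}" using bij_betw_imp_surj_on[OF f] that by simp
    then show ?thesis by (elim imageE) auto
  qed
  have QQ: "Q face_of Q" "P face_of P"
    using P Q by (simp_all add: face_of_refl polytope_imp_convex)
  have fP: "f P = Q"
  proof -
    obtain F where F: "F face_of P" "f F = Q" using surj QQ by blast
    then have "Q \<subseteq> f P" using ord[OF F(1) QQ(2)] face_of_imp_subset by blast
    then show ?thesis using ff[OF QQ(2)] face_of_imp_subset by blast
  qed
  have dQ: "aff_dim Q = CARD('d)" using dim[OF QQ(2)] d fP by simp
  have ve: "v i extreme_point_of P" for i using v by (auto simp: bij_betw_def)
  have vf: "{v i} face_of P" for i using ve by (simp add: face_of_singleton)
  \<comment> \<open>The isomorphism preserves dimension, so it maps vertices to vertices and, below,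
    facets to facets; incidence is inclusion of faces and is preserved too.\<close>
  have "\<exists>y. f {v i} = {y}" for i
    using dim[OF vf[of i]] by (simp add: aff_dim_eq_0)
  then obtain x where x: "\<And>i. f {v i} = {x i}" by metis
  have xe: "x i extreme_point_of Q" for i
    using ff[OF vf[of i]] by (simp add: x face_of_singleton)
  have ext: "range x = {y. y extreme_point_of Q}"
  proof (intro subset_antisym subsetI)
    fix y assume "y \<in> {y. y extreme_point_of Q}"
    then have "{y} face_of Q" by (simp add: face_of_singleton)
    then obtain F where F: "F face_of P" "f F = {y}" using surj by blast
    then have "aff_dim F = 0" using dim[OF F(1)] by simp
    then obtain w where w: "F = {w}" by (auto simp: aff_dim_eq_0)
    then have "w extreme_point_of P" using F by (simp add: face_of_singleton)
    then obtain i where "w = v i" using v by (auto simp: bij_betw_def)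
    then show "y \<in> range x" using F w x by auto
  qed (use xe in auto)
  have Qhull: "Q = convex hull range x" using ext polytope_convex_hull_extreme_points[OF Q(1)] by simp
  have ef: "e j facet_of P" for j using e by (auto simp: bij_betw_def)
  have efc: "e j face_of P" for j using ef facet_of_imp_face_of by blast
  have "f (e j) facet_of Q" for j
  proof -
    have "aff_dim (f (e j)) = aff_dim Q - 1"
      using dim[OF efc[of j]] ef[of j] dQ d by (simp add: facet_of_def)
    moreover have "aff_dim (e j) \<noteq> -1" using ef[of j] aff_dim_empty[of "e j"] by (simp add: facet_of_def)
    then have "f (e j) \<noteq> {}" using dim[OF efc[of j]] aff_dim_empty[of "f (e j)"] by auto
    ultimately show ?thesis using ff[OF efc] by (simp add: facet_of_def)
  qed
  then have "\<exists>a b. a \<noteq> 0 \<and> Q \<subseteq> {x. a \<bullet> x \<le> b} \<and> f (e j) = Q \<inter> {x. a \<bullet> x = b}" for j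
    using facet_of_polyhedron[OF polytope_imp_polyhedron[OF Q(1)]] by metis
  then obtain h c where h: "\<And>j. h j \<noteq> 0" "\<And>j. Q \<subseteq> {x. h j \<bullet> x \<le> c j}"
    "\<And>j. f (e j) = Q \<inter> {x. h j \<bullet> x = c j}"
    by metis
  have xQ: "x i \<in> Q" for i using xe by (simp add: extreme_point_of_def)
  have inc: "h j \<bullet> x i = c j \<longleftrightarrow> v i \<in> e j" for i j
    using ord[OF vf efc, of i j] xQ[of i] by (auto simp: x h(3))
  have "aff_dim (range x) = DIM(real^'d)" using dQ Qhull by (simp add: aff_dim_convex_hull)
  moreover have "h j \<bullet> x i \<le> c j" for i j using h(2) xQ by blast
  moreover have "range x \<subseteq> sphere z r" using ext r(2) by simp
  ultimately obtain A :: "real^'n^'n" and B :: "real^'m^'m" and S :: "real^'m^'n"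
    where X: "positive_semidefinite (bordered_matrix A S B)"
    "rank (bordered_matrix A S B) = DIM(real^'d) + 1"
    "\<And>i. A $ i $ i = 2" "\<And>i j. 0 \<le> S $ i $ j" and S: "\<And>i j. S $ i $ j = 0 \<longleftrightarrow> h j \<bullet> x i = c j"
    using sphere_vertices_imp_bordered_matrix[OF r(1), of x z h c] h(1) by metis
  obtain h' c' where fd: "facet_description P h' c'" "\<And>j. {x \<in> P. h' j \<bullet> x = c' j} = e j"
    using facet_description_exists[OF P _ e] d by auto
  define T :: "real^'m^'n" where "T = (\<chi> i j. c' j - h' j \<bullet> v i)"
  have "slack_matrix P T" unfolding slack_matrix_def T_def using v fd(1) by blast
  moreover have "same_support S T"
  proof -
    have "v i \<in> P" for i using ve by (simp add: extreme_point_of_def)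
    then have "v i \<in> e j \<longleftrightarrow> h' j \<bullet> v i = c' j" for i j using fd(2)[of j] by blast
    then show ?thesis unfolding same_support_def T_def S inc by auto
  qed
  ultimately show ?thesis using X by auto
qed

section \<open>From the matrix to an inscribed polytope\<close>

lemma bordered_matrix_gram:
  fixes A :: "real^'n^'n" and B :: "real^'m^'m" and S :: "real^'m^'n"
  assumes X: "positive_semidefinite (bordered_matrix A S B)"
    and rank: "rank (bordered_matrix A S B) = CARD('d) + 1"
  obtains u :: "'n \<Rightarrow> real^'d" and w :: "'m \<Rightarrow> real^'d"
  where "\<And>i. u i \<bullet> u i = A $ i $ i - 1" "\<And>i j. w j \<bullet> u i = S $ i $ j - 1"
proof -
  let ?X = "bordered_matrix A S B"
  \<comment> \<open>The corner and its border consist of ones, so this pivot subtracts 1 from every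
    entry and lowers the rank to at most \<open>CARD('d)\<close>.\<close>
  define p :: "unit + 'n + 'm" where "p = Inl ()"
  have pp: "?X $ p $ p \<noteq> 0" by (simp add: bordered_matrix_def p_def)
  let ?Y = "\<chi> i j. ?X $ i $ j - ?X $ i $ p * ?X $ p $ j / ?X $ p $ p"
  have rY: "rank ?Y \<le> CARD('d)" using schur_complement_rank_less[OF pp] rank by simp
  obtain g :: "unit + 'n + 'm \<Rightarrow> real^'d" where g: "\<And>i j. ?Y $ i $ j = g i \<bullet> g j"
    using positive_semidefinite_gram[OF schur_complement_positive_semidefinite[OF X pp] rY] by blast
  show ?thesis
  proof (rule that[of "\<lambda>i. g (Inr (Inl i))" "\<lambda>j. g (Inr (Inr j))"])
    show "g (Inr (Inl i)) \<bullet> g (Inr (Inl i)) = A $ i $ i - 1" for i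
      unfolding g[symmetric] by (simp add: bordered_matrix_def p_def)
    show "g (Inr (Inr j)) \<bullet> g (Inr (Inl i)) = S $ i $ j - 1" for i j
      unfolding g[symmetric] by (simp add: bordered_matrix_def p_def transpose_def)
  qed
qed

lemma bordered_matrix_imp_inscribable:
  fixes P :: "(real^'d) set" and A :: "real^'n^'n" and B :: "real^'m^'m" and S :: "real^'m^'n"
  assumes P: "polytope P" and d: "aff_dim P = int CARD('d)"
    and X: "positive_semidefinite (bordered_matrix A S B)"
    and rank: "rank (bordered_matrix A S B) = CARD('d) + 1"
    and A: "\<And>i. A $ i $ i = a" and S: "\<And>i j. 0 \<le> S $ i $ j"
    and T: "slack_matrix P T" and supp: "same_support S T"
  shows "inscribable P"
proof -
  obtain v :: "'n \<Rightarrow> real^'d" and h :: "'m \<Rightarrow> real^'d" and c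
    where v: "bij_betw v UNIV {x. x extreme_point_of P}" and fd: "facet_description P h c"
      and Teq: "T = (\<chi> i j. c j - h j \<bullet> v i)"
    using T unfolding slack_matrix_def by blast
  define e where "e j = {x \<in> P. h j \<bullet> x = c j}" for j
  have Ph: "P = {x. \<forall>j. h j \<bullet> x \<le> c j}" and e: "bij_betw e UNIV {F. F facet_of P}"
    using fd unfolding facet_description_def e_def by auto
  have ve: "v i extreme_point_of P" for i using v by (auto simp: bij_betw_def)
  have vP: "v i \<in> P" for i using ve by (simp add: extreme_point_of_def)
  have inc: "S $ i $ j = 0 \<longleftrightarrow> h j \<bullet> v i = c j" for i j
  proof -
    have "S $ i $ j = 0 \<longleftrightarrow> T $ i $ j = 0" using supp unfolding same_support_def by blast
    then show ?thesis by (auto simp: Teq)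
  qed
  obtain u :: "'n \<Rightarrow> real^'d" and w :: "'m \<Rightarrow> real^'d"
    where u: "\<And>i. u i \<bullet> u i = A $ i $ i - 1" and w: "\<And>i j. w j \<bullet> u i = S $ i $ j - 1"
    using bordered_matrix_gram[OF X rank] by metis
  have vi: "inv_into UNIV v (v i) = i" for i using v by (simp add: bij_betw_def)
  have ei: "inv_into UNIV e (e j) = j" for j using e by (simp add: bij_betw_def)
  define u' where "u' x = u (inv_into UNIV v x)" for x
  define H where "H K = - w (inv_into UNIV e K)" for K
  interpret facet_realization P u' H
  proof
    fix x K assume "x extreme_point_of P" "K facet_of P"
    then obtain i j where ij: "x = v i" "K = e j" using v e unfolding bij_betw_def by blast
    have HK: "H K \<bullet> u' x = 1 - S $ i $ j" by (simp add: ij H_def u'_def vi ei w)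
    show "H K \<bullet> u' x \<le> 1" using S by (simp add: HK)
    show "H K \<bullet> u' x = 1 \<longleftrightarrow> x \<in> K" unfolding HK by (simp add: ij inc e_def vP)
  qed (rule P)
  have ext: "{x. x extreme_point_of P} = range v" and fac: "{K. K facet_of P} = range e"
    using v e by (auto simp: bij_betw_def)
  have uv: "u' ` range v = range u" by (simp add: image_image u'_def vi)
  define Q where "Q = convex hull range u"
  have "Q = {y. \<forall>K. K facet_of P \<longrightarrow> H K \<bullet> y \<le> 1}"
    using convex_hull_eq_facet_inequalities d unfolding Q_def ext uv by simp
  also have "\<dots> = {y. \<forall>K\<in>range e. H K \<bullet> y \<le> 1}" unfolding fac[symmetric] by blast
  also have "\<dots> = {y. \<forall>j. (- w j) \<bullet> y \<le> 1}" by (simp add: H_def ei)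
  finally have QH: "Q = {y. \<forall>j. (- w j) \<bullet> y \<le> 1}" .
  have Pv: "P = convex hull range v" using polytope_convex_hull_extreme_points[OF P] ext by simp
  \<comment> \<open>Incidences are compared for indexed generating points, so the argument works
    before the \<open>u i\<close> are known to be the vertices of \<open>Q\<close>.\<close>
  have ce: "combinatorially_equivalent P Q"
    by (rule combinatorially_equivalent_of_incidence[OF Pv Ph Q_def QH])
       (simp add: w inc[symmetric])
  have pQ: "polytope Q" unfolding Q_def by (rule polytope_convex_hull) simp
  \<comment> \<open>Radius zero would put every \<open>u i\<close> at the origin, yet a vertex on a
    facet has inner product 1 with the functional of that facet.\<close>
  have "a - 1 \<noteq> 0"
  proof
    assume "a - 1 = 0"
    then have u0: "u i = 0" for i using u[of i] A[of i] by simp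
    have "0 < aff_dim P" using d by simp
    then obtain K where K: "K facet_of P" using polytope_facet_exists[OF P] by blast
    then have "K face_of P" "K \<noteq> {}" by (auto simp: facet_of_def)
    then obtain x where "x extreme_point_of P" "x \<in> K"
      using extreme_point_not_in_subface[of "{}" K] by auto
    then have "H K \<bullet> u' x = 1" using eq K by blast
    then show False by (simp add: u'_def u0)
  qed
  moreover have "0 \<le> a - 1" using u[of undefined] A by (metis inner_ge_zero)
  ultimately have "0 < sqrt (a - 1)" by simp
  moreover have "{x. x extreme_point_of Q} \<subseteq> sphere 0 (sqrt (a - 1))"
  proof -
    have "{x. x extreme_point_of Q} \<subseteq> range u" unfolding Q_def using extreme_point_of_convex_hull by blast
    moreover have "norm (u i) = sqrt (a - 1)" for i using u A by (simp add: norm_eq_sqrt_inner)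
    ultimately show ?thesis by auto
  qed
  ultimately show ?thesis unfolding inscribable_def using pQ ce by blast
qed

theorem theorem1:
  fixes P :: "(real^'d) set"
  assumes "polytope P"
    and "aff_dim P = int CARD('d)"
    and "card {v. v extreme_point_of P} = CARD('n::finite)"
    and "card {F. F facet_of P} = CARD('m::finite)"
  shows "inscribable P \<longleftrightarrow>
    (\<exists>(A :: real^'n^'n) (B :: real^'m^'m) (S :: real^'m^'n).
       positive_semidefinite (bordered_matrix A S B) \<and>
       rank (bordered_matrix A S B) = CARD('d) + 1 \<and>
       (\<exists>a. \<forall>i. A $ i $ i = a) \<and>
       (\<forall>i j. 0 \<le> S $ i $ j) \<and>
       (\<exists>T. slack_matrix P T \<and> same_support S T))"
proof
  have "finite {F. F facet_of P}"
    by (rule finite_subset[OF _ finite_polytope_faces[OF assms(1)]]) (auto simp: facet_of_def)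
  then obtain e where e: "bij_betw e (UNIV :: 'm set) {F. F facet_of P}"
    using finite_same_card_bij[OF finite_class.finite_UNIV] assms(4) by metis
  obtain v where v: "bij_betw v (UNIV :: 'n set) {x. x extreme_point_of P}"
    using finite_same_card_bij[OF finite_class.finite_UNIV finite_extreme_points_polytope[OF assms(1)]]
      assms(3) by metis
  assume "inscribable P"
  then show "\<exists>(A :: real^'n^'n) (B :: real^'m^'m) (S :: real^'m^'n).
       positive_semidefinite (bordered_matrix A S B) \<and>
       rank (bordered_matrix A S B) = CARD('d) + 1 \<and>
       (\<exists>a. \<forall>i. A $ i $ i = a) \<and>
       (\<forall>i j. 0 \<le> S $ i $ j) \<and>
       (\<exists>T. slack_matrix P T \<and> same_support S T)"
    by (rule inscribable_imp_bordered_matrix[OF assms(1,2) v e])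
qed (use bordered_matrix_imp_inscribable[OF assms(1,2)] in blast)

end
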